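(* The statement qNCC-I implies the statement qNCC-II, where these are the following two statements. (qNCC-I) There exist $\epsilon>0$ and $C>0$ such that for every measure $\sigma\in\mathcal M(\mathbb T)$ whose Schur parameters $\{\gamma_g\}_{g\ge 0}$ satisfy $\|\{\gamma_g\}\|_{\ell^2(\mathbb Z_+)}\le \epsilon$, one has $$\int_{\mathbb T} M^2(\xi,\sigma)\,d\sigma(\xi)\le C\,\|\{\gamma_g\}\|_{\ell^2(\mathbb Z_+)}^2 .$$ (qNCC-II) There exist $\epsilon>0$ and $C>0$ such that for every sequence $\{\gamma_g\}_{g\ge 0}$ with $\gamma_g\in\mathbb D$ and $\|\{\gamma_g\}\|_{\ell^2(\mathbb Z_+)}\le \epsilon$, one has $$\int_{\mathbb T}\log\bigl(1+O^2(\xi,\{\gamma_g\})\bigr)\,dm(\xi)\le C\,\|\{\gamma_g\}\|_{\ell^2(\mathbb Z_+)}^2 .$$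
   Context: Notation: $\mathbb Z_+=\{0,1,2,\dots\}$, $\mathbb T=\{z\in\mathbb C:|z|=1\}$, $\mathbb D=\{z\in\mathbb C:|z|<1\}$, and $m$ is normalized Lebesgue measure on $\mathbb T$, $dm=d\theta/(2\pi)$. $\mathcal M(\mathbb T)$ is the set of probability measures on $\mathbb T$ whose support is not a finite set. For $\sigma\in\mathcal M(\mathbb T)$, $\Phi_n(z,\sigma)$, $n\in\mathbb Z_+$, are the monic orthogonal polynomials: $\Phi_n(z,\sigma)=z^n+\dots$ has degree $n$ and $\int_{\mathbb T}\Phi_n(\xi,\sigma)\overline{\xi^j}\,d\sigma(\xi)=0$ for all $0\le j\le n-1$. Put $\Phi_n^*(z,\sigma)=z^n\overline{\Phi_n(\bar z^{-1},\sigma)}$. The Schur (Verblunsky) parameters $\{\gamma_n\}_{n\ge0}\subset\mathbb D$ of $\sigma$ are defined by the recursion $$\Phi_{n+1}=z\Phi_n-\overline{\gamma_n}\,\Phi_n^*,\qquad \Phi_{n+1}^*=\Phi_n^*-\gamma_n z\Phi_n,\qquad \Phi_0=\Phi_0^*=1.$$ The map sending $\sigma$ to its Schur parameters is a bijection between $\mathcal M(\mathbb T)$ and the set of all sequences in $\mathbb D$. The maximal function is $$M(\xi,\sigma)=\sup_{n\ge0}|\Phi_n^*(\xi,\sigma)-1|,\qquad \xi\in\mathbb T.$$ For a sequence $\{\gamma_g\}_{g\ge0}\subset\mathbb D$, put $\rho_n=(1-|\gamma_n|^2)^{1/2}$ and, for $\xi\in\mathbb T$, $$\Omega_n(\xi,\{\gamma_g\})=\rho_n^{-1}\begin{pmatrix}1&\overline{\gamma_n}\,\xi^{-n}\\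 \gamma_n\xi^n&1\end{pmatrix},\qquad \Pi_n(\xi,\{\gamma_g\})=\Omega_n\Omega_{n-1}\cdots\Omega_0,$$ $$O(\xi,\{\gamma_g\})=\sup_{n\ge0}\|\Pi_n(\xi,\{\gamma_g\})-I\|_2\in[0,\infty],$$ where $I$ is the $2\times2$ identity matrix and $\|A\|_2=\sqrt{\operatorname{tr}(A^*A)}$ is the Frobenius norm. *)

theory Defs
  imports "HOL-Probability.Probability" "HOL-Computational_Algebra.Polynomial"
begin

abbreviation circle :: "complex set" where
  "circle \<equiv> sphere 0 1"

abbreviation circle_borel :: "complex measure" where
  "circle_borel \<equiv> restrict_space borel circle"

definition circle_lebesgue :: "complex measure" where
  "circle_lebesgue = distr (uniform_measure lborel {0..2 * pi}) circle_borel cis"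

lemma prob_space_circle_lebesgue: "prob_space circle_lebesgue"
proof -
  have "prob_space (uniform_measure lborel {0..2 * pi})"
    by (rule prob_space_uniform_measure) auto
  moreover have "cis \<in> measurable (uniform_measure lborel {0..2 * pi}) circle_borel"
    by (intro measurable_restrict_space2 borel_measurable_continuous_onI)
       (auto simp: measurable_lborel1 measurable_cong_sets[OF sets_uniform_measure refl]
             intro!: borel_measurable_continuous_onI continuous_intros)
  ultimately show ?thesis
    unfolding circle_lebesgue_def by (rule prob_space.prob_space_distr)
qed

text \<open>The topological support of a Borel measure on the circle.\<close>

definition circle_support :: "complex measure \<Rightarrow> complex set" where
  "circle_support \<sigma> = {\<xi> \<in> circle. \<forall>U. open U \<and> \<xi> \<in> U \<longrightarrow> emeasure \<sigma> (U \<inter> circle) > 0}"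

definition circle_prob_measures :: "complex measure set" where
  "circle_prob_measures =
     {\<sigma>. sets \<sigma> = sets circle_borel \<and> prob_space \<sigma> \<and> infinite (circle_support \<sigma>)}"

definition is_monic_orth_poly :: "complex measure \<Rightarrow> nat \<Rightarrow> complex poly \<Rightarrow> bool" where
  "is_monic_orth_poly \<sigma> n p \<longleftrightarrow>
     degree p = n \<and> lead_coeff p = 1 \<and>
     (\<forall>j<n. (LINT \<xi>|\<sigma>. poly p \<xi> * cnj (\<xi> ^ j)) = 0)"

definition orth_poly :: "complex measure \<Rightarrow> nat \<Rightarrow> complex poly" where
  "orth_poly \<sigma> n = (THE p. is_monic_orth_poly \<sigma> n p)"

text \<open>The reversed polynomial \<open>z\<^sup>n * cnj (p (1 / cnj z))\<close> for \<open>n = degree p\<close>; the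
  polynomial form also gives it the right value at \<open>z = 0\<close>.\<close>

definition rev_poly :: "complex poly \<Rightarrow> complex poly" where
  "rev_poly p = map_poly cnj (reflect_poly p)"

lemma poly_rev_poly:
  assumes "z \<noteq> 0"
  shows "poly (rev_poly p) z = z ^ degree p * cnj (poly p (inverse (cnj z)))"
proof -
  have "poly (rev_poly p) z = cnj (poly (reflect_poly p) (cnj z))"
    unfolding rev_poly_def by simp
  also have "\<dots> = z ^ degree p * cnj (poly p (inverse (cnj z)))"
    using assms by (simp add: poly_reflect_poly_nz)
  finally show ?thesis .
qed

abbreviation orth_poly_rev :: "complex measure \<Rightarrow> nat \<Rightarrow> complex poly" where
  "orth_poly_rev \<sigma> n \<equiv> rev_poly (orth_poly \<sigma> n)"

definition schur_parameters :: "complex measure \<Rightarrow> (nat \<Rightarrow> complex) \<Rightarrow> bool" where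
  "schur_parameters \<sigma> \<gamma> \<longleftrightarrow>
     (\<forall>n. \<gamma> n \<in> ball 0 1 \<and>
        orth_poly \<sigma> (Suc n) = [:0, 1:] * orth_poly \<sigma> n - smult (cnj (\<gamma> n)) (orth_poly_rev \<sigma> n) \<and>
        orth_poly_rev \<sigma> (Suc n) = orth_poly_rev \<sigma> n - smult (\<gamma> n) ([:0, 1:] * orth_poly \<sigma> n))"

definition orth_poly_maximal :: "complex \<Rightarrow> complex measure \<Rightarrow> ennreal" where
  "orth_poly_maximal \<xi> \<sigma> = (SUP n. ennreal (cmod (poly (orth_poly_rev \<sigma> n) \<xi> - 1)))"

definition square_summable :: "(nat \<Rightarrow> complex) \<Rightarrow> bool" where
  "square_summable \<gamma> \<longleftrightarrow> summable (\<lambda>n. (cmod (\<gamma> n))\<^sup>2)"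

definition l2_norm :: "(nat \<Rightarrow> complex) \<Rightarrow> real" where
  "l2_norm \<gamma> = sqrt (\<Sum>n. (cmod (\<gamma> n))\<^sup>2)"

definition rho :: "complex \<Rightarrow> real" where
  "rho c = sqrt (1 - (cmod c)\<^sup>2)"

definition transfer_factor :: "complex \<Rightarrow> (nat \<Rightarrow> complex) \<Rightarrow> nat \<Rightarrow> complex^2^2" where
  "transfer_factor \<xi> \<gamma> n =
     inverse (rho (\<gamma> n)) *\<^sub>R
       vector [vector [1, cnj (\<gamma> n) * inverse \<xi> ^ n],
               vector [\<gamma> n * \<xi> ^ n, 1]]"

primrec transfer_prod :: "complex \<Rightarrow> (nat \<Rightarrow> complex) \<Rightarrow> nat \<Rightarrow> complex^2^2" where
  "transfer_prod \<xi> \<gamma> 0 = transfer_factor \<xi> \<gamma> 0"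
| "transfer_prod \<xi> \<gamma> (Suc n) = transfer_factor \<xi> \<gamma> (Suc n) ** transfer_prod \<xi> \<gamma> n"

definition conj_transpose :: "complex^'n^'m \<Rightarrow> complex^'m^'n" where
  "conj_transpose A = (\<chi> i j. cnj (A $ j $ i))"

definition frobenius_norm :: "complex^'n^'n \<Rightarrow> real" where
  "frobenius_norm A = sqrt (Re (trace (conj_transpose A ** A)))"

lemma frobenius_norm_eq_norm: "frobenius_norm A = norm A"
proof -
  have "Re (trace (conj_transpose A ** A)) = (\<Sum>j\<in>UNIV. \<Sum>i\<in>UNIV. (cmod (A $ i $ j))\<^sup>2)"
    by (simp add: trace_def conj_transpose_def matrix_matrix_mult_def cmod_def power2_eq_square)
  also have "\<dots> = (\<Sum>i\<in>UNIV. \<Sum>j\<in>UNIV. (cmod (A $ i $ j))\<^sup>2)"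
    by (rule sum.swap)
  also have "\<dots> = (\<Sum>i\<in>UNIV. (norm (A $ i))\<^sup>2)"
    by (simp add: norm_vec_def L2_set_def sum_nonneg)
  finally show ?thesis
    by (simp add: frobenius_norm_def norm_vec_def[of A] L2_set_def)
qed

definition transfer_maximal :: "complex \<Rightarrow> (nat \<Rightarrow> complex) \<Rightarrow> ennreal" where
  "transfer_maximal \<xi> \<gamma> = (SUP n. ennreal (frobenius_norm (transfer_prod \<xi> \<gamma> n - mat 1)))"

text \<open>The natural logarithm on \<open>[1, \<infinity>]\<close>, with \<open>ln \<infinity> = \<infinity>\<close> (below 1 it is truncated to 0).\<close>

definition ln_ennreal :: "ennreal \<Rightarrow> ennreal" where
  "ln_ennreal x = (if x = \<infinity> then \<infinity> else ennreal (ln (enn2real x)))"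

text \<open>Finiteness of the \<open>\<ell>\<^sup>2\<close> norm is part of the smallness
  condition in both statements, since \<^const>\<open>l2_norm\<close> is only meaningful for square summable sequences.\<close>

definition qNCC_I :: bool where
  "qNCC_I \<longleftrightarrow>
     (\<exists>\<epsilon>>0. \<exists>C>0. \<forall>\<sigma>\<in>circle_prob_measures. \<forall>\<gamma>.
        schur_parameters \<sigma> \<gamma> \<and> square_summable \<gamma> \<and> l2_norm \<gamma> \<le> \<epsilon> \<longrightarrow>
        (\<integral>\<^sup>+\<xi>. (orth_poly_maximal \<xi> \<sigma>)\<^sup>2 \<partial>\<sigma>) \<le> ennreal (C * (l2_norm \<gamma>)\<^sup>2))"

definition qNCC_II :: bool where
  "qNCC_II \<longleftrightarrow>
     (\<exists>\<epsilon>>0. \<exists>C>0. \<forall>\<gamma>.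
        (\<forall>n. \<gamma> n \<in> ball 0 1) \<and> square_summable \<gamma> \<and> l2_norm \<gamma> \<le> \<epsilon> \<longrightarrow>
        (\<integral>\<^sup>+\<xi>. ln_ennreal (1 + (transfer_maximal \<xi> \<gamma>)\<^sup>2) \<partial>circle_lebesgue)
          \<le> ennreal (C * (l2_norm \<gamma>)\<^sup>2))"

end

theory Submission
  imports Defs "HOL-Complex_Analysis.Cauchy_Integral_Formula"
begin

text \<open>
  The partial products \<open>\<Pi>\<^sub>n\<close> are the normalised Szego recursion in disguise. Applied to the vector
  \<open>(1, \<eta> / \<xi>)\<close> with \<open>\<eta> = \<plusminus>1\<close>, the product \<open>\<Pi>\<^sub>n\<close> returns the orthogonal polynomials of degree
  \<open>n + 1\<close> for the Schur parameters \<open>- \<eta> \<gamma>\<close>, divided by their norms and up to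
  unimodular factors. These two vectors form an orthogonal basis, so on the circle the squared distance of \<open>\<Pi>\<^sub>n\<close> from the identity is exactly
  \<open>|K \<Phi>* - 1|\<^sup>2 + |K \<Psi>* - 1|\<^sup>2\<close>, where \<open>\<Phi>*\<close> and \<open>\<Psi>*\<close> are the reversed polynomials for
  \<open>- \<gamma>\<close> and \<open>\<gamma>\<close> (\<open>frobenius_norm_transfer_prod\<close>). The constant \<open>K\<close> is the product of the
  \<open>1 / \<rho>\<^sub>k\<close>, and \<open>K - 1 = O(S)\<close> with \<open>S = \<parallel>\<gamma>\<parallel>\<^sup>2\<close>. Hence \<open>O\<^sup>2\<close> is controlled by the squares of the maximal
  functions of the two measures belonging to \<open>\<plusminus>\<gamma>\<close>.

  It remains to pass from an integral of \<open>M\<^sup>2\<close> against \<open>\<sigma>\<close> to an integral of \<open>log (1 + M\<^sup>2)\<close> against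
  Lebesgue measure. Let \<open>w\<close> be the density of \<open>\<sigma>\<close>. Where \<open>w\<close> is bounded below,
  \<open>log (1 + M\<^sup>2) \<le> M\<^sup>2\<close> is dominated by \<open>M\<^sup>2 w\<close>. Where \<open>w\<close> is small, the logarithm only costs an
  additional \<open>- log w\<close>. This term must be integrated to order \<open>S\<close>, while the integral of \<open>|log w|\<close> is in
  general of order \<open>\<surd>S\<close>; but for small \<open>w\<close> it is dominated by the nonnegative entropy integrand
  \<open>w - 1 - log w\<close>, which vanishes to second order at \<open>w = 1\<close> (\<open>ln_one_plus_le_entropy\<close>). Szego's
  identity \<open>\<integral> log w dm = \<Sum> log (1 - |\<gamma>\<^sub>k|\<^sup>2)\<close> together with \<open>\<integral> w dm = 1\<close> bounds the integral of that
  integrand by \<open>2 S\<close> when \<open>S \<le> 1 / 2\<close>.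

  Singular parts and the limit theorems of Szego's theory are avoided by truncation. The first
  \<open>N\<close> products depend on finitely many \<open>\<gamma>\<^sub>k\<close> only, and for a parameter sequence that vanishes from
  index \<open>N\<close> on the measure is explicit: it is the Bernstein-Szego measure with density
  \<open>\<Prod> (1 - |\<gamma>\<^sub>k|\<^sup>2) / |\<Phi>\<^sub>N*|\<^sup>2\<close>. For it, orthogonality, total mass and entropy all follow from the mean
  value property, because \<open>\<Phi>\<^sub>N*\<close> has no zeros in the closed disc. Monotone convergence in \<open>N\<close>
  then gives the bound for the full supremum.
\<close>

section \<open>Integration over the circle\<close>

lemma sets_circle_lebesgue [measurable_cong]: "sets circle_lebesgue = sets circle_borel"
  by (simp add: circle_lebesgue_def)

lemma space_circle_lebesgue: "space circle_lebesgue = circle"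
  by (simp add: circle_lebesgue_def space_restrict_space)

lemma cis_measurable: "cis \<in> measurable (uniform_measure lborel {0..2 * pi}) circle_borel"
  by (intro measurable_restrict_space2 borel_measurable_continuous_onI)
     (auto simp: measurable_lborel1 measurable_cong_sets[OF sets_uniform_measure refl]
           intro!: borel_measurable_continuous_onI continuous_intros)

lemma continuous_on_circle_measurable:
  fixes f :: "complex \<Rightarrow> 'a::topological_space"
  assumes "sets \<sigma> = sets circle_borel" "continuous_on circle f"
  shows "f \<in> borel_measurable \<sigma>"
  using borel_measurable_continuous_on_restrict[OF assms(2)]
  by (simp add: measurable_cong_sets[OF assms(1) refl])

lemma continuous_on_circle_integrable:
  fixes f :: "complex \<Rightarrow> 'a::{banach, second_countable_topology}"
  assumes "prob_space \<sigma>" and \<sigma>: "sets \<sigma> = sets circle_borel" and f: "continuous_on circle f"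
  shows "integrable \<sigma> f"
proof -
  interpret prob_space \<sigma> by fact
  have "space \<sigma> = circle"
    using sets_eq_imp_space_eq[OF \<sigma>] by (simp add: space_restrict_space)
  moreover have "compact (f ` circle)"
    using f by (intro compact_continuous_image) auto
  then obtain B where "\<And>z. z \<in> circle \<Longrightarrow> norm (f z) \<le> B"
    by (meson bounded_iff compact_imp_bounded imageI)
  ultimately show ?thesis
    using continuous_on_circle_measurable[OF \<sigma> f]
    by (intro integrable_const_bound[where B = B]) auto
qed

lemmas continuous_on_circle_lebesgue_integrable =
  continuous_on_circle_integrable[OF prob_space_circle_lebesgue sets_circle_lebesgue]

text \<open>The parametrisation by \<open>cis\<close> turns the abstract push-forward measure into the Henstock-Kurzweil
  integral in which contour integrals over circles are expressed.\<close>

lemma integral_circle_lebesgue: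
  fixes f :: "complex \<Rightarrow> complex"
  assumes "continuous_on circle f"
  shows "(LINT \<xi>|circle_lebesgue. f \<xi>) = integral {0..2 * pi} (\<lambda>t. f (cis t)) / (2 * pi)"
proof -
  let ?u = "uniform_measure lborel {0..2 * pi}"
  have cont: "continuous_on {0..2 * pi} (\<lambda>t. f (cis t))"
    by (rule continuous_on_compose2[OF assms]) (auto intro!: continuous_intros)
  have dens: "?u = density lborel (\<lambda>t. ennreal (indicator {0..2 * pi} t / (2 * pi)))"
  proof -
    have "indicator {0..2 * pi} t / ennreal (2 * pi) = ennreal (indicator {0..2 * pi} t / (2 * pi))" for t
      using divide_ennreal[of "indicator {0..2 * pi} t" "2 * pi"] by (simp add: ennreal_indicator)
    then show ?thesis
      unfolding uniform_measure_def by simp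
  qed
  have meas: "(\<lambda>t. f (cis t)) \<in> borel_measurable lborel"
  proof -
    have "(\<lambda>t. f (cis t)) \<in> borel_measurable ?u"
      using measurable_compose[OF cis_measurable borel_measurable_continuous_on_restrict[OF assms]] .
    then show ?thesis by (simp add: measurable_cong_sets[OF sets_uniform_measure refl])
  qed
  have "(LINT \<xi>|circle_lebesgue. f \<xi>) = (LINT t|?u. f (cis t))"
    unfolding circle_lebesgue_def
    by (rule integral_distr[OF cis_measurable borel_measurable_continuous_on_restrict[OF assms]])
  also have "\<dots> = (LINT t|lborel. (indicator {0..2 * pi} t / (2 * pi)) *\<^sub>R f (cis t))"
    unfolding dens using meas by (intro integral_density) auto
  also have "\<dots> = (LINT t|lborel. (1 / (2 * pi)) *\<^sub>R (indicator {0..2 * pi} t *\<^sub>R f (cis t)))"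
    by (intro Bochner_Integration.integral_cong) (auto simp: indicator_def)
  also have "\<dots> = (1 / (2 * pi)) *\<^sub>R (LINT t:{0..2 * pi}|lborel. f (cis t))"
    unfolding set_lebesgue_integral_def by (rule integral_scaleR_right)
  also have "\<dots> = (1 / (2 * pi)) *\<^sub>R integral {0..2 * pi} (\<lambda>t. f (cis t))"
    by (subst set_borel_integral_eq_integral(2)[OF borel_integrable_atLeastAtMost'[OF cont]]) simp
  finally show ?thesis by (simp add: scaleR_conv_of_real field_simps)
qed

text \<open>Cauchy's formula at the centre, for functions that are only continuous up to the boundary. All
  integrals over the circle that are evaluated below come from this identity.\<close>

lemma circle_mean_value:
  assumes cont: "continuous_on (cball 0 1) f" and hol: "f holomorphic_on ball 0 1"
  shows "(LINT \<xi>|circle_lebesgue. f \<xi>) = f 0"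
proof -
  have "((\<lambda>u. f u / (u - 0)) has_contour_integral (2 * of_real pi * \<i> * f 0)) (circlepath 0 1)"
    using cont hol by (rule Cauchy_integral_circlepath) auto
  then have "((\<lambda>t. f (0 + of_real 1 * cis t) / (0 + of_real 1 * cis t - 0) * of_real 1 * \<i> * cis t)
               has_integral (2 * of_real pi * \<i> * f 0)) {0..2 * pi}"
    unfolding circlepath_def by (subst (asm) has_contour_integral_part_circlepath_iff) auto
  then have "((\<lambda>t. \<i> * f (cis t)) has_integral (2 * of_real pi * \<i> * f 0)) {0..2 * pi}"
    by (simp add: field_simps)
  then have "((\<lambda>t. \<i> * f (cis t)) has_integral (\<i> * (2 * of_real pi * f 0))) {0..2 * pi}"
    by (simp add: mult_ac)
  from has_integral_mult_right[OF this, of "- \<i>"]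
  have "((\<lambda>t. f (cis t)) has_integral (2 * of_real pi * f 0)) {0..2 * pi}"
    by (simp flip: mult.assoc)
  moreover have "continuous_on circle f"
    using cont by (rule continuous_on_subset) (auto simp: sphere_cball)
  ultimately show ?thesis
    by (simp add: integral_circle_lebesgue integral_unique)
qed

text \<open>Points with argument in the open interval \<open>(0, 2\<pi>)\<close> are enough to produce an infinite support,
  and leaving out \<open>\<xi> = 1\<close> keeps the preimage of a neighbourhood inside one period.\<close>

lemma circle_lebesgue_open_pos:
  assumes "open U" "cis t \<in> U" "0 < t" "t < 2 * pi"
  shows "emeasure circle_lebesgue (U \<inter> circle) > 0"
proof -
  let ?V = "{0<..<2 * pi} \<inter> cis -` U"
  have oV: "open ?V"
    using assms by (intro open_Int open_vimage) (auto intro!: continuous_intros)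
  have "emeasure lborel ?V > 0"
  proof -
    have "t \<in> ?V"
      using assms by simp
    then obtain e where e: "e > 0" "ball t e \<subseteq> ?V"
      by (rule openE[OF oV])
    have "0 < emeasure lborel {t - e<..<t + e}"
      using e(1) by simp
    also have "\<dots> \<le> emeasure lborel ?V"
      using e oV by (intro emeasure_mono) (auto simp: ball_eq_greaterThanLessThan)
    finally show ?thesis .
  qed
  moreover have "emeasure lborel ?V \<le> emeasure lborel ({0..2 * pi} \<inter> cis -` (U \<inter> circle))"
  proof (rule emeasure_mono)
    have "closed (cis -` circle)" "open (cis -` U)"
      using assms by (auto intro!: closed_vimage open_vimage continuous_intros)
    then show "{0..2 * pi} \<inter> cis -` (U \<inter> circle) \<in> sets lborel"
      by (auto simp: vimage_Int)
  qed auto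
  moreover have "emeasure circle_lebesgue (U \<inter> circle)
      = emeasure lborel ({0..2 * pi} \<inter> cis -` (U \<inter> circle)) / emeasure lborel {0..2 * pi}"
  proof -
    have mU: "U \<inter> circle \<in> sets circle_borel"
      using assms by (auto simp: sets_restrict_space)
    show ?thesis
      unfolding circle_lebesgue_def
      using measurable_sets[OF cis_measurable mU]
      by (subst emeasure_distr[OF cis_measurable mU]) (simp add: emeasure_uniform_measure)
  qed
  ultimately show ?thesis
    by (auto simp: ennreal_zero_less_divide)
qed

lemma circle_support_open_pos:
  assumes "\<And>U t. open U \<Longrightarrow> cis t \<in> U \<Longrightarrow> 0 < t \<Longrightarrow> t < 2 * pi \<Longrightarrow> emeasure \<sigma> (U \<inter> circle) > 0"
  shows "infinite (circle_support \<sigma>)"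
proof -
  have "cis ` {0<..<pi} \<subseteq> circle_support \<sigma>"
    using assms by (auto simp: circle_support_def)
  moreover have "inj_on cis {0<..<pi}"
    by (rule inj_onI) (auto simp: complex_eq_iff intro: cos_inj_pi)
  then have "infinite (cis ` {0<..<pi})"
    using pi_gt_zero by (subst finite_image_iff) (auto simp: infinite_Ioo)
  ultimately show ?thesis
    using finite_subset by blast
qed

section \<open>The Szego recursion\<close>

text \<open>The reversed polynomial is carried along as a second component instead of being computed by
  \<^const>\<open>rev_poly\<close>, so that the recursion is primitive and does not refer to degrees; the two
  notions are reconciled in \<open>rev_poly_szego_poly\<close>.\<close>

primrec szego_pair :: "(nat \<Rightarrow> complex) \<Rightarrow> nat \<Rightarrow> complex poly \<times> complex poly" where
  "szego_pair \<gamma> 0 = (1, 1)"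
| "szego_pair \<gamma> (Suc n) =
     (let (p, q) = szego_pair \<gamma> n
      in ([:0, 1:] * p - smult (cnj (\<gamma> n)) q, q - smult (\<gamma> n) ([:0, 1:] * p)))"

definition szego_poly :: "(nat \<Rightarrow> complex) \<Rightarrow> nat \<Rightarrow> complex poly" where
  "szego_poly \<gamma> n = fst (szego_pair \<gamma> n)"

definition szego_rev :: "(nat \<Rightarrow> complex) \<Rightarrow> nat \<Rightarrow> complex poly" where
  "szego_rev \<gamma> n = snd (szego_pair \<gamma> n)"

lemma szego_0 [simp]: "szego_poly \<gamma> 0 = 1" "szego_rev \<gamma> 0 = 1"
  by (simp_all add: szego_poly_def szego_rev_def)

lemma szego_poly_Suc:
    "szego_poly \<gamma> (Suc n) = [:0, 1:] * szego_poly \<gamma> n - smult (cnj (\<gamma> n)) (szego_rev \<gamma> n)"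
  and szego_rev_Suc:
    "szego_rev \<gamma> (Suc n) = szego_rev \<gamma> n - smult (\<gamma> n) ([:0, 1:] * szego_poly \<gamma> n)"
  by (simp_all add: szego_poly_def szego_rev_def case_prod_unfold Let_def)

lemma szego_cong:
  assumes "\<And>k. k < n \<Longrightarrow> \<gamma> k = \<gamma>' k"
  shows "szego_poly \<gamma> n = szego_poly \<gamma>' n" "szego_rev \<gamma> n = szego_rev \<gamma>' n"
  using assms by (induction n) (simp_all add: szego_poly_Suc szego_rev_Suc)

lemma szego_rev_at_0 [simp]: "poly (szego_rev \<gamma> n) 0 = 1"
  by (induction n) (simp_all add: szego_rev_Suc)

lemma degree_szego_poly: "degree (szego_poly \<gamma> n) = n"
  and lead_coeff_szego_poly: "lead_coeff (szego_poly \<gamma> n) = 1"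
proof -
  have "degree (szego_poly \<gamma> n) \<le> n \<and> coeff (szego_poly \<gamma> n) n = 1 \<and> degree (szego_rev \<gamma> n) \<le> n"
  proof (induction n)
    case (Suc n)
    have "degree ([:0, 1:] * szego_poly \<gamma> n) \<le> Suc n"
      using Suc degree_mult_le[of "[:0, 1:]" "szego_poly \<gamma> n"] by simp
    moreover have "coeff (szego_rev \<gamma> n) (Suc n) = 0"
      using Suc by (intro coeff_eq_0) auto
    ultimately show ?case
      using Suc unfolding szego_poly_Suc szego_rev_Suc
      by (auto intro!: degree_diff_le simp: coeff_pCons degree_smult_le[THEN order_trans])
  qed auto
  then have "degree (szego_poly \<gamma> n) \<le> n" "coeff (szego_poly \<gamma> n) n = 1" by auto
  then show "degree (szego_poly \<gamma> n) = n" "lead_coeff (szego_poly \<gamma> n) = 1"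
    using le_degree[of "szego_poly \<gamma> n" n] by auto
qed

text \<open>Both identities are needed at once: each step of the recursion expresses either component through
  both.\<close>

lemma szego_poly_reflection:
  assumes "z \<noteq> 0"
  shows "poly (szego_rev \<gamma> n) z = z ^ n * cnj (poly (szego_poly \<gamma> n) (inverse (cnj z)))"
    and "poly (szego_poly \<gamma> n) z = z ^ n * cnj (poly (szego_rev \<gamma> n) (inverse (cnj z)))"
proof -
  have "poly (szego_rev \<gamma> n) z = z ^ n * cnj (poly (szego_poly \<gamma> n) (inverse (cnj z))) \<and>
        poly (szego_poly \<gamma> n) z = z ^ n * cnj (poly (szego_rev \<gamma> n) (inverse (cnj z)))"
    using assms by (induction n) (simp_all add: szego_poly_Suc szego_rev_Suc field_simps)
  then show "poly (szego_rev \<gamma> n) z = z ^ n * cnj (poly (szego_poly \<gamma> n) (inverse (cnj z)))"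
    and "poly (szego_poly \<gamma> n) z = z ^ n * cnj (poly (szego_rev \<gamma> n) (inverse (cnj z)))"
    by auto
qed

text \<open>Two polynomials are compared through their values; the factor \<open>z\<close> disposes of the point \<open>z = 0\<close>,
  where the reflection formula is not available.\<close>

lemma rev_poly_szego_poly: "rev_poly (szego_poly \<gamma> n) = szego_rev \<gamma> n"
proof -
  have "poly ([:0, 1:] * rev_poly (szego_poly \<gamma> n)) = poly ([:0, 1:] * szego_rev \<gamma> n)"
  proof
    fix z show "poly ([:0, 1:] * rev_poly (szego_poly \<gamma> n)) z = poly ([:0, 1:] * szego_rev \<gamma> n) z"
      by (cases "z = 0")
         (simp_all add: poly_rev_poly szego_poly_reflection(1)[of z] degree_szego_poly)
  qed
  then show ?thesis
    by (simp only: poly_eq_poly_eq_iff) simp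
qed

lemma szego_poly_on_circle:
  assumes "\<xi> \<in> circle"
  shows "poly (szego_poly \<gamma> n) \<xi> = \<xi> ^ n * cnj (poly (szego_rev \<gamma> n) \<xi>)"
proof -
  have "cnj \<xi> * \<xi> = 1"
    using assms complex_norm_square[of \<xi>] by (simp add: mult.commute)
  then have "\<xi> \<noteq> 0" "inverse (cnj \<xi>) = \<xi>"
    by (auto intro: inverse_unique)
  then show ?thesis
    using szego_poly_reflection(2)[of \<xi>] by simp
qed

text \<open>With \<open>a = z \<Phi>\<^sub>n\<close>, \<open>b = \<Phi>\<^sub>n*\<close> and \<open>g = \<gamma>\<^sub>n\<close> the recursion is a hyperbolic rotation up to scaling:
  \<open>|b - g a|\<^sup>2 - |a - cnj g b|\<^sup>2 = (1 - |g|\<^sup>2) (|b|\<^sup>2 - |a|\<^sup>2)\<close>, so \<open>|a| \<le> |b|\<close> propagates, and then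
  \<open>|g a| < |b|\<close> excludes zeros of \<open>b - g a\<close>.\<close>

lemma szego_rev_dominates:
  assumes "\<And>k. \<gamma> k \<in> ball 0 1" "z \<in> cball 0 1"
  shows "poly (szego_rev \<gamma> n) z \<noteq> 0"
    and "cmod (poly (szego_poly \<gamma> n) z) \<le> cmod (poly (szego_rev \<gamma> n) z)"
proof -
  have "poly (szego_rev \<gamma> n) z \<noteq> 0 \<and> cmod (poly (szego_poly \<gamma> n) z) \<le> cmod (poly (szego_rev \<gamma> n) z)"
  proof (induction n)
    case (Suc n)
    define a b g where "a = z * poly (szego_poly \<gamma> n) z" and "b = poly (szego_rev \<gamma> n) z" and "g = \<gamma> n"
    have g: "cmod g < 1" using assms by (auto simp: g_def)
    have ab: "cmod a \<le> cmod b"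
      using Suc assms(2) mult_mono[of "cmod z" 1 "cmod (poly (szego_poly \<gamma> n) z)" "cmod b"]
      by (simp add: a_def b_def norm_mult)
    have b: "b \<noteq> 0" using Suc by (simp add: b_def)
    have "cmod (g * a) < cmod b"
    proof -
      have "cmod (g * a) \<le> cmod g * cmod b"
        using ab by (simp add: norm_mult mult_left_mono)
      also have "\<dots> < 1 * cmod b"
        using g b by (intro mult_strict_right_mono) auto
      finally show ?thesis by simp
    qed
    then have "b - g * a \<noteq> 0" by auto
    moreover have "(cmod (a - cnj g * b))\<^sup>2 \<le> (cmod (b - g * a))\<^sup>2"
    proof -
      have "(cmod (b - g * a))\<^sup>2 - (cmod (a - cnj g * b))\<^sup>2
              = (1 - (cmod g)\<^sup>2) * ((cmod b)\<^sup>2 - (cmod a)\<^sup>2)"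
        by (simp only: cmod_power2) (simp add: power2_eq_square algebra_simps)
      moreover have "0 \<le> 1 - (cmod g)\<^sup>2" "0 \<le> (cmod b)\<^sup>2 - (cmod a)\<^sup>2"
        using g ab by (auto simp: power_le_one power_mono)
      ultimately show ?thesis
        using mult_nonneg_nonneg[of "1 - (cmod g)\<^sup>2" "(cmod b)\<^sup>2 - (cmod a)\<^sup>2"] by linarith
    qed
    then have "cmod (a - cnj g * b) \<le> cmod (b - g * a)"
      by (rule power2_le_imp_le) auto
    ultimately show ?case
      by (simp add: szego_poly_Suc szego_rev_Suc a_def b_def g_def mult_ac)
  qed auto
  then show "poly (szego_rev \<gamma> n) z \<noteq> 0"
    and "cmod (poly (szego_poly \<gamma> n) z) \<le> cmod (poly (szego_rev \<gamma> n) z)" by auto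
qed

section \<open>Bernstein-Szego measures\<close>

lemma continuous_on_circle_szego:
  assumes "\<And>k. \<gamma> k \<in> ball 0 1" "continuous_on circle f"
  shows "continuous_on circle (\<lambda>\<xi>. f \<xi> / (poly (szego_rev \<gamma> n) \<xi> * cnj (poly (szego_rev \<gamma> n) \<xi>)))"
  using szego_rev_dominates(1)[OF assms(1)] assms(2)
  by (intro continuous_intros) (auto simp: sphere_cball)

lemma integral_power_div_szego_rev:
  assumes "\<And>k. \<gamma> k \<in> ball 0 1"
  shows "(LINT \<xi>|circle_lebesgue. \<xi> ^ k / poly (szego_rev \<gamma> n) \<xi>) = 0 ^ k"
proof -
  have "(LINT \<xi>|circle_lebesgue. \<xi> ^ k / poly (szego_rev \<gamma> n) \<xi>) = 0 ^ k / poly (szego_rev \<gamma> n) 0"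
    using szego_rev_dominates(1)[OF assms]
    by (intro circle_mean_value continuous_intros holomorphic_intros) auto
  then show ?thesis by simp
qed

text \<open>Orthogonality of all \<open>\<Phi>\<^sub>n\<close> with \<open>n \<le> N\<close> with respect to the single weight \<open>1 / |\<Phi>\<^sub>N*|\<^sup>2\<close>. For
  \<open>n = N\<close> the weight cancels one factor and leaves \<open>\<xi>\<^sup>k / \<Phi>\<^sub>N*\<close> or its conjugate, which the mean
  value property evaluates. Smaller \<open>n\<close> are reached by solving the recursion backwards:
  \<open>(1 - |\<gamma>\<^sub>n|\<^sup>2) z \<Phi>\<^sub>n = \<Phi>\<^bsub>n+1\<^esub> + cnj \<gamma>\<^sub>n \<Phi>\<^bsub>n+1\<^esub>*\<close> and
  \<open>(1 - |\<gamma>\<^sub>n|\<^sup>2) \<Phi>\<^sub>n* = \<Phi>\<^bsub>n+1\<^esub>* + \<gamma>\<^sub>n \<Phi>\<^bsub>n+1\<^esub>\<close>. The statement about \<open>\<Phi>\<^sub>n*\<close> is needed to keep this downward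
  induction going, and its last part, at \<open>n = 0\<close>, is the total mass.\<close>

lemma szego_orthogonality:
  assumes \<gamma>: "\<And>k. \<gamma> k \<in> ball 0 1" and "n \<le> N"
  defines "w \<equiv> \<lambda>\<xi>. poly (szego_rev \<gamma> N) \<xi> * cnj (poly (szego_rev \<gamma> N) \<xi>)"
  shows "j < n \<Longrightarrow> (LINT \<xi>|circle_lebesgue. poly (szego_poly \<gamma> n) \<xi> * cnj (\<xi> ^ j) / w \<xi>) = 0"
    and "0 < j \<Longrightarrow> j \<le> n \<Longrightarrow> (LINT \<xi>|circle_lebesgue. poly (szego_rev \<gamma> n) \<xi> * cnj (\<xi> ^ j) / w \<xi>) = 0"
    and "(LINT \<xi>|circle_lebesgue. poly (szego_rev \<gamma> n) \<xi> / w \<xi>)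
           * (\<Prod>k=n..<N. of_real (1 - (cmod (\<gamma> k))\<^sup>2)) = 1"
proof -
  define L where "L f = (LINT \<xi>|circle_lebesgue. f \<xi> / w \<xi>)" for f :: "complex \<Rightarrow> complex"
  let ?P = "\<lambda>n j \<xi>. poly (szego_poly \<gamma> n) \<xi> * cnj (\<xi> ^ j)"
  let ?Q = "\<lambda>n j \<xi>. poly (szego_rev \<gamma> n) \<xi> * cnj (\<xi> ^ j)"
  have w: "w \<xi> \<noteq> 0" if "\<xi> \<in> circle" for \<xi>
    using szego_rev_dominates(1)[OF \<gamma>, of \<xi>] that by (simp add: w_def)
  have int: "integrable circle_lebesgue (\<lambda>\<xi>. f \<xi> / w \<xi>)" if "continuous_on circle f" for f
    unfolding w_def by (intro continuous_on_circle_lebesgue_integrable continuous_on_circle_szego that \<gamma>)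
  have L_cong: "L f = L g" if "\<And>\<xi>. \<xi> \<in> circle \<Longrightarrow> f \<xi> = g \<xi>" for f g
    unfolding L_def using that
    by (intro Bochner_Integration.integral_cong) (auto simp: space_circle_lebesgue)
  \<comment> \<open>The leading term carries no coefficient; the backward recursion has this shape.\<close>
  have L_linear: "L (\<lambda>\<xi>. f \<xi> + c * g \<xi>) = L f + c * L g"
    if "continuous_on circle f" "continuous_on circle g" for f g c
  proof -
    have "L (\<lambda>\<xi>. f \<xi> + c * g \<xi>) = (LINT \<xi>|circle_lebesgue. f \<xi> / w \<xi> + c * (g \<xi> / w \<xi>))"
      unfolding L_def by (simp add: add_divide_distrib)
    also have "\<dots> = L f + c * L g"
      unfolding L_def using int[OF that(1)] int[OF that(2)]
      by (simp del: times_divide_eq_right)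
    finally show ?thesis .
  qed
  have contP: "continuous_on circle (?P n j)" and contQ: "continuous_on circle (?Q n j)" for n j
    by (intro continuous_intros)+
  have "(\<forall>j<n. L (?P n j) = 0) \<and> (\<forall>j. 0 < j \<and> j \<le> n \<longrightarrow> L (?Q n j) = 0) \<and>
        L (?Q n 0) * (\<Prod>k=n..<N. of_real (1 - (cmod (\<gamma> k))\<^sup>2)) = 1"
    using \<open>n \<le> N\<close>
  proof (induction n rule: inc_induct)
    case base
    have "L (?P N j) = 0" if "j < N" for j
    proof -
      have "L (?P N j) = (LINT \<xi>|circle_lebesgue. \<xi> ^ (N - j) / poly (szego_rev \<gamma> N) \<xi>)"
        unfolding L_def
      proof (intro Bochner_Integration.integral_cong refl)
        fix \<xi> assume "\<xi> \<in> space circle_lebesgue"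
        then have \<xi>: "\<xi> \<in> circle" by (simp add: space_circle_lebesgue)
        then have "\<xi> ^ j * cnj (\<xi> ^ j) = 1"
          using complex_norm_square[of "\<xi> ^ j"] by (simp add: norm_power)
        moreover have "\<xi> ^ N = \<xi> ^ (N - j) * \<xi> ^ j"
          using that by (simp flip: power_add)
        ultimately have "\<xi> ^ N * cnj (\<xi> ^ j) = \<xi> ^ (N - j)"
          by (metis mult.assoc mult.right_neutral)
        then show "?P N j \<xi> / w \<xi> = \<xi> ^ (N - j) / poly (szego_rev \<gamma> N) \<xi>"
          using w[OF \<xi>] szego_poly_on_circle[OF \<xi>, of \<gamma> N] by (simp add: w_def field_simps)
      qed
      then show ?thesis
        using that by (simp add: integral_power_div_szego_rev[OF \<gamma>] power_0_left)
    qed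
    moreover have Q: "L (?Q N j) = 0 ^ j" for j
    proof -
      have "L (?Q N j) = (LINT \<xi>|circle_lebesgue. cnj (\<xi> ^ j / poly (szego_rev \<gamma> N) \<xi>))"
        unfolding L_def
        by (intro Bochner_Integration.integral_cong refl) (use w in \<open>auto simp: w_def space_circle_lebesgue\<close>)
      also have "\<dots> = cnj (0 ^ j)"
        using integral_power_div_szego_rev[OF \<gamma>, where k = j and n = N] by (simp del: complex_cnj_divide)
      finally show ?thesis by simp
    qed
    moreover from Q[of 0] have "L (?Q N 0) = 1"
      by (simp only: power_0)
    ultimately show ?case by (simp add: power_0_left)
  next
    case (step n)
    define r :: complex where "r = of_real (1 - (cmod (\<gamma> n))\<^sup>2)"
    have r: "r \<noteq> 0"
      using \<gamma>[of n] by (auto simp: r_def power_less_one_iff abs_square_eq_1 simp flip: of_real_power)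
    have r': "r = 1 - \<gamma> n * cnj (\<gamma> n)"
      using complex_norm_square[of "\<gamma> n"] by (simp add: r_def)
    \<comment> \<open>The recursion is solved for \<open>\<xi> \<Phi>\<^sub>n\<close>; moving \<open>\<xi>\<close> to the other factor raises \<open>j\<close> by one.\<close>
    have P_step: "r * L (?P n j) = L (?P (Suc n) (Suc j)) + cnj (\<gamma> n) * L (?Q (Suc n) (Suc j))" for j
    proof -
      have "L (\<lambda>\<xi>. 0 + r * ?P n j \<xi>) = L (\<lambda>\<xi>. ?P (Suc n) (Suc j) \<xi> + cnj (\<gamma> n) * ?Q (Suc n) (Suc j) \<xi>)"
      proof (rule L_cong)
        fix \<xi> assume "\<xi> \<in> circle"
        then have "\<xi> * cnj \<xi> = 1"
          using complex_norm_square[of \<xi>] by simp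
        then have "?P n j \<xi> = \<xi> * poly (szego_poly \<gamma> n) \<xi> * cnj (\<xi> ^ Suc j)"
          by (simp add: mult_ac)
        moreover have "?P (Suc n) (Suc j) \<xi> + cnj (\<gamma> n) * ?Q (Suc n) (Suc j) \<xi>
            = r * (\<xi> * poly (szego_poly \<gamma> n) \<xi> * cnj (\<xi> ^ Suc j))"
          unfolding r' by (simp add: szego_poly_Suc szego_rev_Suc algebra_simps)
        ultimately show "0 + r * ?P n j \<xi> = ?P (Suc n) (Suc j) \<xi> + cnj (\<gamma> n) * ?Q (Suc n) (Suc j) \<xi>"
          by (simp only: add_0_left)
      qed
      then show ?thesis
        unfolding L_linear[OF contP contQ] L_linear[OF continuous_on_const contP]
        by (simp add: L_def)
    qed
    have Q_step: "r * L (?Q n j) = L (?Q (Suc n) j) + \<gamma> n * L (?P (Suc n) j)" for j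
    proof -
      have "L (\<lambda>\<xi>. 0 + r * ?Q n j \<xi>) = L (\<lambda>\<xi>. ?Q (Suc n) j \<xi> + \<gamma> n * ?P (Suc n) j \<xi>)"
        unfolding r' by (rule L_cong) (simp add: szego_poly_Suc szego_rev_Suc algebra_simps)
      then show ?thesis
        unfolding L_linear[OF contQ contP] L_linear[OF continuous_on_const contQ]
        by (simp add: L_def)
    qed
    have IH: "j < Suc n \<Longrightarrow> L (?P (Suc n) j) = 0"
             "0 < j \<Longrightarrow> j \<le> Suc n \<Longrightarrow> L (?Q (Suc n) j) = 0"
             "L (?Q (Suc n) 0) * (\<Prod>k=Suc n..<N. of_real (1 - (cmod (\<gamma> k))\<^sup>2)) = 1" for j
      using step.IH by blast+
    have "L (?P n j) = 0" if "j < n" for j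
    proof -
      have "L (?P (Suc n) (Suc j)) = 0" "L (?Q (Suc n) (Suc j)) = 0"
        using that by (intro IH; simp)+
      with P_step[of j] r show ?thesis
        by (simp only: mult_zero_right add_0 mult_eq_0_iff simp_thms)
    qed
    moreover have "L (?Q n j) = 0" if "0 < j" "j \<le> n" for j
    proof -
      have "L (?Q (Suc n) j) = 0" "L (?P (Suc n) j) = 0"
        using that by (intro IH; simp)+
      with Q_step[of j] r show ?thesis
        by (simp only: mult_zero_right add_0 mult_eq_0_iff simp_thms)
    qed
    moreover have "L (?Q n 0) * (\<Prod>k=n..<N. of_real (1 - (cmod (\<gamma> k))\<^sup>2)) = 1"
    proof -
      have "L (?Q (Suc n) 0) = r * L (?Q n 0)"
        using Q_step[of 0] IH(1)[of 0] by (simp only: mult_zero_right add_0_right zero_less_Suc)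
      moreover have "(\<Prod>k=n..<N. of_real (1 - (cmod (\<gamma> k))\<^sup>2))
          = r * (\<Prod>k=Suc n..<N. of_real (1 - (cmod (\<gamma> k))\<^sup>2))"
        using step.hyps by (simp only: prod.atLeast_Suc_lessThan r_def)
      ultimately show ?thesis
        using IH(3) by (simp only: mult.assoc mult.left_commute)
    qed
    ultimately show ?case by blast
  qed
  then show "j < n \<Longrightarrow> (LINT \<xi>|circle_lebesgue. poly (szego_poly \<gamma> n) \<xi> * cnj (\<xi> ^ j) / w \<xi>) = 0"
    and "0 < j \<Longrightarrow> j \<le> n \<Longrightarrow> (LINT \<xi>|circle_lebesgue. poly (szego_rev \<gamma> n) \<xi> * cnj (\<xi> ^ j) / w \<xi>) = 0"
    and "(LINT \<xi>|circle_lebesgue. poly (szego_rev \<gamma> n) \<xi> / w \<xi>)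
           * (\<Prod>k=n..<N. of_real (1 - (cmod (\<gamma> k))\<^sup>2)) = 1"
    unfolding L_def by auto
qed

section \<open>Uniqueness of orthogonal polynomials\<close>

text \<open>The difference of two candidates has degree below \<open>n\<close> and is orthogonal to all lower powers, in
  particular to itself. It therefore vanishes almost everywhere, and a measure with infinite support
  charges the open complement of a finite zero set.\<close>

lemma orth_poly_eqI:
  assumes \<sigma>: "\<sigma> \<in> circle_prob_measures" and p: "is_monic_orth_poly \<sigma> n p"
  shows "orth_poly \<sigma> n = p"
  unfolding orth_poly_def
proof (rule the_equality)
  show "is_monic_orth_poly \<sigma> n p" by fact
next
  fix q assume q: "is_monic_orth_poly \<sigma> n q"
  define d where "d = q - p"
  have prob: "prob_space \<sigma>" and sets: "sets \<sigma> = sets circle_borel"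
    and inf: "infinite (circle_support \<sigma>)"
    using \<sigma> by (auto simp: circle_prob_measures_def)
  note int = continuous_on_circle_integrable[OF prob sets]
  show "q = p"
  proof (rule ccontr)
    assume "q \<noteq> p"
    then have d0: "d \<noteq> 0" by (simp add: d_def)
    have "degree d \<le> n" "coeff d n = 0"
      using p q by (auto simp: d_def is_monic_orth_poly_def intro: degree_diff_le)
    then have deg: "degree d < n"
      using d0 by (metis le_neq_implies_less leading_coeff_0_iff)
    have orth: "(LINT \<xi>|\<sigma>. poly d \<xi> * cnj (\<xi> ^ j)) = 0" if "j < n" for j
    proof -
      have "(LINT \<xi>|\<sigma>. poly d \<xi> * cnj (\<xi> ^ j))
          = (LINT \<xi>|\<sigma>. poly q \<xi> * cnj (\<xi> ^ j) - poly p \<xi> * cnj (\<xi> ^ j))"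
        by (simp add: d_def left_diff_distrib)
      also have "\<dots> = (LINT \<xi>|\<sigma>. poly q \<xi> * cnj (\<xi> ^ j)) - (LINT \<xi>|\<sigma>. poly p \<xi> * cnj (\<xi> ^ j))"
        by (intro Bochner_Integration.integral_diff int continuous_intros)
      also have "\<dots> = 0"
        using p q that by (simp add: is_monic_orth_poly_def)
      finally show ?thesis .
    qed
    have "of_real (LINT \<xi>|\<sigma>. (cmod (poly d \<xi>))\<^sup>2) = (LINT \<xi>|\<sigma>. poly d \<xi> * cnj (poly d \<xi>))"
      by (simp add: complex_norm_square[symmetric] flip: integral_complex_of_real)
    also have "\<dots> = (LINT \<xi>|\<sigma>. (\<Sum>i\<le>degree d. cnj (coeff d i) * (poly d \<xi> * cnj (\<xi> ^ i))))"
      by (subst (2) poly_altdef) (simp add: sum_distrib_left mult_ac)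
    also have "\<dots> = (\<Sum>i\<le>degree d. cnj (coeff d i) * (LINT \<xi>|\<sigma>. poly d \<xi> * cnj (\<xi> ^ i)))"
      by (subst Bochner_Integration.integral_sum)
         (auto intro!: int continuous_intros Bochner_Integration.integral_mult_right sum.cong)
    also have "\<dots> = 0"
      using orth deg by (intro sum.neutral) auto
    finally have "(LINT \<xi>|\<sigma>. (cmod (poly d \<xi>))\<^sup>2) = 0" by simp
    then have "AE \<xi> in \<sigma>. (cmod (poly d \<xi>))\<^sup>2 = 0"
      by (subst (asm) integral_nonneg_eq_0_iff_AE) (auto intro!: int continuous_intros)
    then have ae: "AE \<xi> in \<sigma>. \<xi> \<notin> {z. poly d z \<noteq> 0} \<inter> circle"
      by eventually_elim auto
    have "finite {z. poly d z = 0}"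
      using d0 by (rule poly_roots_finite)
    then obtain z where z: "z \<in> circle_support \<sigma>" "poly d z \<noteq> 0"
      using inf finite_subset[of "circle_support \<sigma>" "{z. poly d z = 0}"] by blast
    have op: "open {z. poly d z \<noteq> 0}"
      by (intro open_Collect_neq continuous_intros)
    then have "{z. poly d z \<noteq> 0} \<inter> circle \<in> sets \<sigma>"
      unfolding sets by (auto simp: sets_restrict_space)
    with ae have "emeasure \<sigma> ({z. poly d z \<noteq> 0} \<inter> circle) = 0"
      using AE_iff_null_sets by blast
    with z op show False
      by (auto simp: circle_support_def)
  qed
qed

section \<open>Bernstein-Szego measures and their Schur parameters\<close>

definition bernstein_szego_density :: "(nat \<Rightarrow> complex) \<Rightarrow> nat \<Rightarrow> complex \<Rightarrow> real" where
  "bernstein_szego_density \<gamma> N \<xi> =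
     (\<Prod>k<N. 1 - (cmod (\<gamma> k))\<^sup>2) / (cmod (poly (szego_rev \<gamma> N) \<xi>))\<^sup>2"

definition bernstein_szego :: "(nat \<Rightarrow> complex) \<Rightarrow> nat \<Rightarrow> complex measure" where
  "bernstein_szego \<gamma> N = density circle_lebesgue (\<lambda>\<xi>. ennreal (bernstein_szego_density \<gamma> N \<xi>))"

lemma rho_sq_pos: "c \<in> ball 0 1 \<Longrightarrow> 0 < 1 - (cmod c)\<^sup>2"
  by (simp add: power_less_one_iff)

text \<open>Used for \<open>x = |\<gamma>\<^sub>k|\<^sup>2\<close>, both for the entropy and for the product of the \<open>1 / \<rho>\<^sub>k\<close>.\<close>

lemma minus_ln_one_minus_le:
  fixes x :: real
  assumes "0 \<le> x" "x \<le> 1 / 2"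
  shows "- ln (1 - x) \<le> 2 * x"
  using ln_one_minus_pos_lower_bound[OF assms] assms mult_left_mono[of x "1/2" x]
  by (simp add: power2_eq_square)

context
  fixes \<gamma> :: "nat \<Rightarrow> complex"
  assumes \<gamma>: "\<And>k. \<gamma> k \<in> ball 0 1"
begin

lemma bernstein_szego_density_pos:
  "\<xi> \<in> circle \<Longrightarrow> 0 < bernstein_szego_density \<gamma> N \<xi>"
  unfolding bernstein_szego_density_def
  using szego_rev_dominates(1)[of \<gamma> \<xi> N] \<gamma>
  by (intro divide_pos_pos prod_pos) (auto simp: power_less_one_iff)

lemma bernstein_szego_density_nonneg: "0 \<le> bernstein_szego_density \<gamma> N \<xi>"
  unfolding bernstein_szego_density_def
  using rho_sq_pos[OF \<gamma>] by (intro divide_nonneg_nonneg prod_nonneg) (auto simp: less_imp_le)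

lemma bernstein_szego_density_continuous:
  "continuous_on circle (bernstein_szego_density \<gamma> N)"
  unfolding bernstein_szego_density_def
  using szego_rev_dominates(1)[OF \<gamma>] by (intro continuous_intros) (auto simp: sphere_cball)

lemmas bernstein_szego_density_measurable =
  continuous_on_circle_measurable[OF sets_circle_lebesgue bernstein_szego_density_continuous]

lemma integral_bernstein_szego:
  fixes f :: "complex \<Rightarrow> complex"
  assumes "continuous_on circle f"
  shows "(LINT \<xi>|bernstein_szego \<gamma> N. f \<xi>) =
    (\<Prod>k<N. of_real (1 - (cmod (\<gamma> k))\<^sup>2)) *
      (LINT \<xi>|circle_lebesgue. f \<xi> / (poly (szego_rev \<gamma> N) \<xi> * cnj (poly (szego_rev \<gamma> N) \<xi>)))"
proof -
  have "(LINT \<xi>|bernstein_szego \<gamma> N. f \<xi>)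
      = (LINT \<xi>|circle_lebesgue. bernstein_szego_density \<gamma> N \<xi> *\<^sub>R f \<xi>)"
    unfolding bernstein_szego_def
    using continuous_on_circle_measurable[OF sets_circle_lebesgue assms] bernstein_szego_density_nonneg
    by (intro integral_density bernstein_szego_density_measurable) auto
  also have "\<dots> = (LINT \<xi>|circle_lebesgue. (\<Prod>k<N. of_real (1 - (cmod (\<gamma> k))\<^sup>2)) *
        (f \<xi> / (poly (szego_rev \<gamma> N) \<xi> * cnj (poly (szego_rev \<gamma> N) \<xi>))))"
    by (simp add: bernstein_szego_density_def scaleR_conv_of_real complex_norm_square[symmetric])
  finally show ?thesis
    by (simp del: times_divide_eq_right)
qed

lemma bernstein_szego_mass: "(LINT \<xi>|circle_lebesgue. bernstein_szego_density \<gamma> N \<xi>) = 1"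
proof -
  have "of_real (LINT \<xi>|circle_lebesgue. bernstein_szego_density \<gamma> N \<xi>)
      = (LINT \<xi>|circle_lebesgue. (\<Prod>k<N. of_real (1 - (cmod (\<gamma> k))\<^sup>2)) *
        (1 / (poly (szego_rev \<gamma> N) \<xi> * cnj (poly (szego_rev \<gamma> N) \<xi>))))"
    by (simp add: bernstein_szego_density_def complex_norm_square[symmetric]
        flip: integral_complex_of_real)
  also have "\<dots> = (\<Prod>k<N. of_real (1 - (cmod (\<gamma> k))\<^sup>2)) *
      (LINT \<xi>|circle_lebesgue. 1 / (poly (szego_rev \<gamma> N) \<xi> * cnj (poly (szego_rev \<gamma> N) \<xi>)))"
    by (rule integral_mult_right_zero)
  also have "\<dots> = 1"
    using szego_orthogonality(3)[where \<gamma> = \<gamma> and n = 0 and N = N, OF \<gamma>]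
    by (simp add: mult.commute lessThan_atLeast0)
  finally show ?thesis
    using of_real_eq_1_iff by blast
qed

lemma bernstein_szego_in_circle_prob_measures: "bernstein_szego \<gamma> N \<in> circle_prob_measures"
proof -
  have "emeasure (bernstein_szego \<gamma> N) (space (bernstein_szego \<gamma> N))
      = (\<integral>\<^sup>+\<xi>. ennreal (bernstein_szego_density \<gamma> N \<xi>) \<partial>circle_lebesgue)"
    unfolding bernstein_szego_def
    using bernstein_szego_density_measurable
    by (subst emeasure_density) (auto intro!: nn_integral_cong)
  also have "\<dots> = 1"
    using bernstein_szego_density_nonneg
    by (subst nn_integral_eq_integral)
       (auto intro!: continuous_on_circle_lebesgue_integrable bernstein_szego_density_continuous
             simp: bernstein_szego_mass)
  finally have "prob_space (bernstein_szego \<gamma> N)" by (rule prob_spaceI)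
  moreover have "infinite (circle_support (bernstein_szego \<gamma> N))"
  proof (rule circle_support_open_pos)
    fix U t assume U: "open U" "cis t \<in> U" "0 < t" "t < 2 * pi"
    then have m: "U \<inter> circle \<in> sets circle_lebesgue"
      by (auto simp: sets_circle_lebesgue sets_restrict_space)
    have "emeasure (bernstein_szego \<gamma> N) (U \<inter> circle) \<noteq> 0"
    proof
      assume "emeasure (bernstein_szego \<gamma> N) (U \<inter> circle) = 0"
      then have "(\<integral>\<^sup>+\<xi>. ennreal (bernstein_szego_density \<gamma> N \<xi>) * indicator (U \<inter> circle) \<xi> \<partial>circle_lebesgue) = 0"
        unfolding bernstein_szego_def
        using bernstein_szego_density_measurable m by (subst (asm) emeasure_density) auto
      then have "AE \<xi> in circle_lebesgue. ennreal (bernstein_szego_density \<gamma> N \<xi>) * indicator (U \<inter> circle) \<xi> = 0"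
        using bernstein_szego_density_measurable m by (subst (asm) nn_integral_0_iff_AE) auto
      then have "AE \<xi> in circle_lebesgue. \<xi> \<notin> U \<inter> circle"
      proof eventually_elim
        case (elim \<xi>)
        then show ?case
          using bernstein_szego_density_pos[of \<xi> N] by (auto simp: indicator_def split: if_splits)
      qed
      then have "emeasure circle_lebesgue (U \<inter> circle) = 0"
        using m AE_iff_null_sets by blast
      with circle_lebesgue_open_pos[OF U] show False by simp
    qed
    then show "emeasure (bernstein_szego \<gamma> N) (U \<inter> circle) > 0"
      by (simp add: zero_less_iff_neq_zero)
  qed
  ultimately show ?thesis
    by (simp add: circle_prob_measures_def bernstein_szego_def sets_circle_lebesgue)
qed

text \<open>Since the reversed polynomial stabilises, so does the Bernstein-Szego measure. The degree in its
  weight may thus be raised at will, which makes orthogonality available for every \<open>n\<close> and not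
  just for \<open>n \<le> N\<close>.\<close>

lemma szego_rev_eventually_const:
  assumes "\<forall>k\<ge>N. \<gamma> k = 0" "N \<le> n"
  shows "szego_rev \<gamma> n = szego_rev \<gamma> N"
  using assms(2) by (induction n rule: dec_induct) (simp_all add: szego_rev_Suc assms(1))

lemma bernstein_szego_eventually_const:
  assumes "\<forall>k\<ge>N. \<gamma> k = 0" "N \<le> n"
  shows "bernstein_szego \<gamma> n = bernstein_szego \<gamma> N"
proof -
  have "(\<Prod>k<n. 1 - (cmod (\<gamma> k))\<^sup>2) = (\<Prod>k<N. 1 - (cmod (\<gamma> k))\<^sup>2)"
    using assms by (intro prod.mono_neutral_right) auto
  then show ?thesis
    by (simp add: bernstein_szego_def bernstein_szego_density_def[abs_def]
        szego_rev_eventually_const[OF assms])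
qed

lemma orth_poly_bernstein_szego:
  assumes "\<forall>k\<ge>N. \<gamma> k = 0"
  shows "orth_poly (bernstein_szego \<gamma> N) n = szego_poly \<gamma> n"
proof (rule orth_poly_eqI[OF bernstein_szego_in_circle_prob_measures])
  have "(LINT \<xi>|bernstein_szego \<gamma> N. poly (szego_poly \<gamma> n) \<xi> * cnj (\<xi> ^ j)) = 0" if "j < n" for j
  proof -
    have "(LINT \<xi>|bernstein_szego \<gamma> (max n N). poly (szego_poly \<gamma> n) \<xi> * cnj (\<xi> ^ j)) = 0"
      using szego_orthogonality(1)[OF \<gamma> _ that, of "max n N"]
      by (subst integral_bernstein_szego) (auto intro!: continuous_intros)
    then show ?thesis
      using bernstein_szego_eventually_const[OF assms, of "max n N"] by simp
  qed
  then show "is_monic_orth_poly (bernstein_szego \<gamma> N) n (szego_poly \<gamma> n)"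
    using lead_coeff_szego_poly by (simp add: is_monic_orth_poly_def degree_szego_poly)
qed

lemma schur_parameters_bernstein_szego:
  assumes "\<forall>k\<ge>N. \<gamma> k = 0"
  shows "schur_parameters (bernstein_szego \<gamma> N) \<gamma>"
  unfolding schur_parameters_def orth_poly_bernstein_szego[OF assms] rev_poly_szego_poly
  using \<gamma> by (auto simp only: szego_poly_Suc szego_rev_Suc)

section \<open>The entropy of a Bernstein-Szego density\<close>

text \<open>Jensen's formula for a polynomial without zeros in the closed disc. The logarithm is assembled
  from principal branches: one step of the recursion multiplies \<open>\<Phi>\<^sub>n*\<close> by \<open>b = 1 - \<gamma>\<^sub>n z \<Phi>\<^sub>n / \<Phi>\<^sub>n*\<close>, whose
  real part is positive, so that the principal logarithm of \<open>b\<close> is holomorphic and vanishes at 0.\<close>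

lemma integral_ln_szego_rev: "(LINT \<xi>|circle_lebesgue. ln (cmod (poly (szego_rev \<gamma> n) \<xi>))) = 0"
proof (induction n)
  case (Suc n)
  define b where "b z = 1 - \<gamma> n * (z * poly (szego_poly \<gamma> n) z / poly (szego_rev \<gamma> n) z)" for z
  have nz: "poly (szego_rev \<gamma> k) z \<noteq> 0" if "z \<in> cball 0 1" for z k
    using szego_rev_dominates(1)[OF \<gamma> that] .
  have b_eq: "b z = poly (szego_rev \<gamma> (Suc n)) z / poly (szego_rev \<gamma> n) z" if "z \<in> cball 0 1" for z
    using nz[OF that] by (simp add: b_def szego_rev_Suc field_simps)
  have Re_b: "0 < Re (b z)" if "z \<in> cball 0 1" for z
  proof -
    have "cmod z * cmod (poly (szego_poly \<gamma> n) z) \<le> 1 * cmod (poly (szego_rev \<gamma> n) z)"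
      using that szego_rev_dominates(2)[OF \<gamma> that] by (intro mult_mono) auto
    then have "cmod (z * poly (szego_poly \<gamma> n) z / poly (szego_rev \<gamma> n) z) \<le> 1"
      using nz[OF that] by (simp add: norm_mult norm_divide)
    then have "cmod (\<gamma> n * (z * poly (szego_poly \<gamma> n) z / poly (szego_rev \<gamma> n) z)) < 1"
      using \<gamma>[of n] unfolding norm_mult[of "\<gamma> n"]
      by (metis dist_0_norm mem_ball mult_le_one mult_left_le norm_ge_zero order_le_less_trans)
    then show ?thesis
      using complex_Re_le_cmod[of "\<gamma> n * (z * poly (szego_poly \<gamma> n) z / poly (szego_rev \<gamma> n) z)"]
      by (simp add: b_def)
  qed
  have slit: "b z \<notin> \<real>\<^sub>\<le>\<^sub>0" if "z \<in> cball 0 1" for z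
    using Re_b[OF that] by (auto simp: complex_nonpos_Reals_iff)
  have contb: "continuous_on (cball 0 1) b"
    unfolding b_def using nz by (intro continuous_intros) auto
  have cont: "continuous_on (cball 0 1) (\<lambda>z. Ln (b z))"
    by (rule continuous_on_Ln'[OF contb slit])
  have "(LINT \<xi>|circle_lebesgue. Ln (b \<xi>)) = Ln (b 0)"
  proof (rule circle_mean_value[OF cont])
    have "b holomorphic_on ball 0 1"
      unfolding b_def using nz by (intro holomorphic_intros) auto
    then show "(\<lambda>z. Ln (b z)) holomorphic_on ball 0 1"
      using slit by (intro holomorphic_intros) auto
  qed
  moreover have "b 0 = 1" by (simp add: b_def)
  ultimately have "Re (LINT \<xi>|circle_lebesgue. Ln (b \<xi>)) = 0" by simp
  moreover have int: "integrable circle_lebesgue (\<lambda>\<xi>. Ln (b \<xi>))"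
    by (intro continuous_on_circle_lebesgue_integrable continuous_on_subset[OF cont]) (auto simp: sphere_cball)
  ultimately have b_int: "(LINT \<xi>|circle_lebesgue. Re (Ln (b \<xi>))) = 0"
    by simp
  have "(LINT \<xi>|circle_lebesgue. ln (cmod (poly (szego_rev \<gamma> (Suc n)) \<xi>)))
      = (LINT \<xi>|circle_lebesgue. ln (cmod (poly (szego_rev \<gamma> n) \<xi>)) + Re (Ln (b \<xi>)))"
  proof (intro Bochner_Integration.integral_cong refl)
    fix \<xi> assume "\<xi> \<in> space circle_lebesgue"
    then have \<xi>: "\<xi> \<in> cball 0 1" by (auto simp: space_circle_lebesgue sphere_cball)
    then have "b \<xi> \<noteq> 0" using slit by force
    then have "Re (Ln (b \<xi>)) = ln (cmod (poly (szego_rev \<gamma> (Suc n)) \<xi>) / cmod (poly (szego_rev \<gamma> n) \<xi>))"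
      using b_eq[OF \<xi>] by (simp add: norm_divide)
    then show "ln (cmod (poly (szego_rev \<gamma> (Suc n)) \<xi>))
        = ln (cmod (poly (szego_rev \<gamma> n) \<xi>)) + Re (Ln (b \<xi>))"
      using nz[OF \<xi>] by (simp add: ln_div)
  qed
  also have "\<dots> = 0"
  proof (subst Bochner_Integration.integral_add)
    show "integrable circle_lebesgue (\<lambda>\<xi>. ln (cmod (poly (szego_rev \<gamma> n) \<xi>)))"
      using nz by (intro continuous_on_circle_lebesgue_integrable continuous_intros) (auto simp: sphere_cball)
  qed (use int Suc b_int in auto)
  finally show ?case .
qed simp

text \<open>Szego's identity for Bernstein-Szego measures.\<close>

lemma integral_ln_bernstein_szego:
  "(LINT \<xi>|circle_lebesgue. ln (bernstein_szego_density \<gamma> N \<xi>)) = (\<Sum>k<N. ln (1 - (cmod (\<gamma> k))\<^sup>2))"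
proof -
  interpret prob_space circle_lebesgue by (rule prob_space_circle_lebesgue)
  have nz: "poly (szego_rev \<gamma> N) \<xi> \<noteq> 0" if "\<xi> \<in> circle" for \<xi>
    using szego_rev_dominates(1)[OF \<gamma>, of \<xi>] that by auto
  have rho_ne: "1 - (cmod (\<gamma> k))\<^sup>2 \<noteq> 0" for k
    using rho_sq_pos[OF \<gamma>[of k]] by simp
  then have ln_prod_rho: "ln (\<Prod>k<N. 1 - (cmod (\<gamma> k))\<^sup>2) = (\<Sum>k<N. ln (1 - (cmod (\<gamma> k))\<^sup>2))"
    using rho_sq_pos[OF \<gamma>] by (intro ln_prod) auto
  have "(LINT \<xi>|circle_lebesgue. ln (bernstein_szego_density \<gamma> N \<xi>))
      = (LINT \<xi>|circle_lebesgue. (\<Sum>k<N. ln (1 - (cmod (\<gamma> k))\<^sup>2)) - 2 * ln (cmod (poly (szego_rev \<gamma> N) \<xi>)))"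
  proof (intro Bochner_Integration.integral_cong refl)
    fix \<xi> assume "\<xi> \<in> space circle_lebesgue"
    then have "poly (szego_rev \<gamma> N) \<xi> \<noteq> 0" using nz by (auto simp: space_circle_lebesgue)
    moreover have "(\<Prod>k<N. 1 - (cmod (\<gamma> k))\<^sup>2) > 0"
      using rho_sq_pos[OF \<gamma>] by (intro prod_pos) auto
    ultimately show "ln (bernstein_szego_density \<gamma> N \<xi>)
      = (\<Sum>k<N. ln (1 - (cmod (\<gamma> k))\<^sup>2)) - 2 * ln (cmod (poly (szego_rev \<gamma> N) \<xi>))"
      unfolding bernstein_szego_density_def
      using rho_ne by (simp add: ln_div ln_realpow flip: ln_prod_rho)
  qed
  also have "\<dots> = (\<Sum>k<N. ln (1 - (cmod (\<gamma> k))\<^sup>2))"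
  proof (subst Bochner_Integration.integral_diff)
    show "integrable circle_lebesgue (\<lambda>\<xi>. 2 * ln (cmod (poly (szego_rev \<gamma> N) \<xi>)))"
      using nz by (intro continuous_on_circle_lebesgue_integrable continuous_intros) auto
  qed (use integral_ln_szego_rev in \<open>auto simp: prob_space\<close>)
  finally show ?thesis .
qed

text \<open>By concavity of the logarithm the integrand is nonnegative; the linear part \<open>w - 1\<close> integrates
  to zero because the measure is normalised. This cancellation is what produces a bound of second order
  in the Schur parameters.\<close>

lemma bernstein_szego_entropy:
  assumes "\<And>k. (cmod (\<gamma> k))\<^sup>2 \<le> 1 / 2"
  shows "(\<integral>\<^sup>+\<xi>. ennreal (bernstein_szego_density \<gamma> N \<xi> - 1 - ln (bernstein_szego_density \<gamma> N \<xi>)) \<partial>circle_lebesgue)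
           \<le> ennreal (2 * (\<Sum>k<N. (cmod (\<gamma> k))\<^sup>2))"
proof -
  let ?w = "bernstein_szego_density \<gamma> N"
  interpret prob_space circle_lebesgue by (rule prob_space_circle_lebesgue)
  have int: "integrable circle_lebesgue ?w" "integrable circle_lebesgue (\<lambda>\<xi>. ln (?w \<xi>))"
    using bernstein_szego_density_pos[of _ N]
    by (intro continuous_on_circle_lebesgue_integrable continuous_intros bernstein_szego_density_continuous;
        fastforce)+
  have "(\<integral>\<^sup>+\<xi>. ennreal (?w \<xi> - 1 - ln (?w \<xi>)) \<partial>circle_lebesgue)
      = ennreal (LINT \<xi>|circle_lebesgue. ?w \<xi> - 1 - ln (?w \<xi>))"
  proof (rule nn_integral_eq_integral)
    show "AE \<xi> in circle_lebesgue. 0 \<le> ?w \<xi> - 1 - ln (?w \<xi>)"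
      using bernstein_szego_density_pos[of _ N] ln_le_minus_one
      by (intro AE_I2) (auto simp: space_circle_lebesgue)
  qed (use int in auto)
  also have "(LINT \<xi>|circle_lebesgue. ?w \<xi> - 1 - ln (?w \<xi>)) = - (\<Sum>k<N. ln (1 - (cmod (\<gamma> k))\<^sup>2))"
    using int by (simp add: bernstein_szego_mass integral_ln_bernstein_szego prob_space)
  also have "\<dots> \<le> 2 * (\<Sum>k<N. (cmod (\<gamma> k))\<^sup>2)"
  proof -
    have "- ln (1 - (cmod (\<gamma> k))\<^sup>2) \<le> 2 * (cmod (\<gamma> k))\<^sup>2" for k
      using minus_ln_one_minus_le[OF _ assms[of k]] by simp
    then show ?thesis
      by (simp add: sum_distrib_left sum_negf[symmetric] sum_mono)
  qed
  finally show ?thesis by (simp add: ennreal_leI)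
qed

end

section \<open>Elementary inequalities\<close>

text \<open>The two regimes are separated at \<open>w = 1 / 2\<close>. Below that value
  \<open>- ln w \<le> 4 (w - 1 - ln w)\<close>, which at the endpoint amounts to \<open>ln 2 \<ge> 2 / 3\<close>; this fixes the
  constant 4. The factor 8 in front of \<open>x\<^sup>2\<close> is the one with which the maximal function enters the
  bound for the transfer matrices.\<close>

lemma ln_one_plus_le_entropy:
  fixes w x :: real
  assumes w: "0 < w"
  shows "ln (1 + 8 * x\<^sup>2) \<le> 16 * x\<^sup>2 * w + 4 * (w - 1 - ln w)"
proof (cases "1 / 2 \<le> w")
  case True
  have "ln (1 + 8 * x\<^sup>2) \<le> 8 * x\<^sup>2"
    by (rule ln_add_one_self_le_self) simp
  also have "\<dots> \<le> 16 * x\<^sup>2 * w"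
    using True mult_left_mono[of "1 / 2" w "16 * x\<^sup>2"] by simp
  finally show ?thesis
    using ln_le_minus_one[OF w] by simp
next
  case False
  have "ln (1 + 8 * x\<^sup>2) \<le> ln ((1 + 8 * x\<^sup>2 * w) / w)"
    using False w by (intro ln_mono) (auto simp: field_simps intro: add_pos_nonneg)
  also have "\<dots> = ln (1 + 8 * x\<^sup>2 * w) - ln w"
  proof -
    have "0 < 1 + 8 * x\<^sup>2 * w" using w by (simp add: add_pos_nonneg)
    then show ?thesis using w by (simp add: ln_div)
  qed
  also have "ln (1 + 8 * x\<^sup>2 * w) \<le> 8 * x\<^sup>2 * w"
    using w by (intro ln_add_one_self_le_self) simp
  finally have "ln (1 + 8 * x\<^sup>2) \<le> 8 * x\<^sup>2 * w - ln w" by simp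
  moreover have "- ln w \<le> 4 * (w - 1 - ln w)"
  proof -
    \<comment> \<open>The tangent at \<open>2 w = 1\<close> is sharp exactly at the endpoint of the regime.\<close>
    have "ln 2 + ln w = ln (2 * w)" using w by (simp add: ln_mult)
    also have "\<dots> \<le> 2 * w - 1" using w by (intro ln_le_minus_one) simp
    finally show ?thesis
      using ln2_ge_two_thirds False by (simp add: algebra_simps)
  qed
  moreover have "8 * x\<^sup>2 * w \<le> 16 * x\<^sup>2 * w" using w by simp
  ultimately show ?thesis by linarith
qed

text \<open>The reduction of the supremum to finitely many transfer products. If the right-hand side is a
  real number \<open>r\<close>, then every \<open>f n\<close> is at most \<open>sqrt (exp r - 1)\<close>.\<close>

lemma ln_ennreal_SUP_le:
  fixes f :: "nat \<Rightarrow> real"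
  assumes "\<And>n. 0 \<le> f n"
  shows "ln_ennreal (1 + (SUP n. ennreal (f n))\<^sup>2)
           \<le> (SUP N. ennreal (ln (1 + Max ((\<lambda>n. (f n)\<^sup>2) ` {..N}))))" (is "_ \<le> ?R")
proof (cases "?R = \<infinity>")
  case False
  then obtain r where r: "?R = ennreal r" "0 \<le> r"
    by (cases ?R) auto
  have "f n \<le> sqrt (exp r - 1)" for n
  proof -
    have "(f n)\<^sup>2 \<le> Max ((\<lambda>n. (f n)\<^sup>2) ` {..n})" (is "_ \<le> ?m")
      by (rule Max_ge[OF _ image_eqI[of _ _ n]]) auto
    then have m: "0 \<le> ?m"
      by (meson order_trans zero_le_power2)
    have "ennreal (ln (1 + ?m)) \<le> ennreal r"
      unfolding r(1)[symmetric] by (rule SUP_upper) simp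
    then have "ln (1 + ?m) \<le> r"
      using r(2) by simp
    then have "1 + ?m \<le> exp r"
      using m by (metis add_pos_nonneg exp_le_cancel_iff exp_ln zero_less_one)
    with \<open>(f n)\<^sup>2 \<le> ?m\<close> show ?thesis
      by (intro real_le_rsqrt) linarith
  qed
  then have "(SUP n. ennreal (f n)) \<le> ennreal (sqrt (exp r - 1))"
    by (intro SUP_least ennreal_leI)
  then have "1 + (SUP n. ennreal (f n))\<^sup>2 \<le> 1 + (ennreal (sqrt (exp r - 1)))\<^sup>2"
    by (intro add_left_mono power_mono) auto
  also have "\<dots> = ennreal (exp r)"
    using r(2) by (simp add: ennreal_power flip: ennreal_plus ennreal_1)
  finally have le: "1 + (SUP n. ennreal (f n))\<^sup>2 \<le> ennreal (exp r)" .
  then have fin: "1 + (SUP n. ennreal (f n))\<^sup>2 \<noteq> \<infinity>"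
    by (auto simp: top_unique)
  have "1 \<le> enn2real (1 + (SUP n. ennreal (f n))\<^sup>2)"
    using fin enn2real_mono[of 1 "1 + (SUP n. ennreal (f n))\<^sup>2"] by (simp add: top.not_eq_extremum)
  moreover have "enn2real (1 + (SUP n. ennreal (f n))\<^sup>2) \<le> exp r"
    using enn2real_mono[OF le] by simp
  ultimately have "ln (enn2real (1 + (SUP n. ennreal (f n))\<^sup>2)) \<le> r"
    by (metis exp_gt_zero ln_exp ln_mono less_le_trans zero_less_one)
  then show ?thesis
    using fin r by (simp add: ln_ennreal_def ennreal_leI)
next
  case True
  then show ?thesis
    by (simp only: infinity_ennreal_def top_greatest)
qed

section \<open>The transfer matrices and the polynomials\<close>

lemma transfer_factor_nth:
  "transfer_factor \<xi> \<gamma> n $ 1 $ 1 = of_real (inverse (rho (\<gamma> n)))"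
  "transfer_factor \<xi> \<gamma> n $ 1 $ 2 = of_real (inverse (rho (\<gamma> n))) * (cnj (\<gamma> n) * inverse \<xi> ^ n)"
  "transfer_factor \<xi> \<gamma> n $ 2 $ 1 = of_real (inverse (rho (\<gamma> n))) * (\<gamma> n * \<xi> ^ n)"
  "transfer_factor \<xi> \<gamma> n $ 2 $ 2 = of_real (inverse (rho (\<gamma> n)))"
  unfolding transfer_factor_def vector_scaleR_component
  by (simp_all add: scaleR_conv_of_real)

text \<open>The first components evolve like \<open>\<xi>\<^sup>-\<^sup>n\<^sup>-\<^sup>1 \<Phi>\<^bsub>n+1\<^esub>\<close>. The starting vector \<open>(1, \<eta> / \<xi>)\<close>, rather than \<open>(1, \<eta>)\<close>,
  accounts for the exponent \<open>n\<close> of \<open>\<xi>\<close> in the transfer factor, where the recursion has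
  \<open>n + 1\<close>. The hypothesis on \<open>\<eta>\<close> leaves the two values \<open>\<plusminus>1\<close>; the sign is absorbed into the Schur
  parameters.\<close>

lemma transfer_prod_szego:
  fixes \<eta> :: real and \<xi> :: complex and \<gamma> :: "nat \<Rightarrow> complex"
  assumes \<xi>: "\<xi> \<noteq> 0" and \<eta>: "\<eta> * \<eta> = 1"
  defines "T \<equiv> transfer_prod \<xi> \<gamma>" and "\<delta> \<equiv> \<lambda>k. - (of_real \<eta> * \<gamma> k)"
    and "K \<equiv> \<lambda>n. complex_of_real (\<Prod>k\<le>n. inverse (rho (\<gamma> k)))"
  shows "T n $ 1 $ 1 + of_real \<eta> * inverse \<xi> * T n $ 1 $ 2
           = K n * (inverse \<xi> ^ Suc n * poly (szego_poly \<delta> (Suc n)) \<xi>)"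
    and "T n $ 2 $ 1 + of_real \<eta> * inverse \<xi> * T n $ 2 $ 2
           = K n * (of_real \<eta> * inverse \<xi> * poly (szego_rev \<delta> (Suc n)) \<xi>)"
proof -
  have \<eta>': "complex_of_real \<eta> * complex_of_real \<eta> = 1"
    using \<eta> by (metis of_real_1 of_real_mult)
  have "T n $ 1 $ 1 + of_real \<eta> * inverse \<xi> * T n $ 1 $ 2
           = K n * (inverse \<xi> ^ Suc n * poly (szego_poly \<delta> (Suc n)) \<xi>) \<and>
        T n $ 2 $ 1 + of_real \<eta> * inverse \<xi> * T n $ 2 $ 2
           = K n * (of_real \<eta> * inverse \<xi> * poly (szego_rev \<delta> (Suc n)) \<xi>)"
  proof (induction n)
    case 0
    show ?case
      using \<xi> by (simp add: T_def K_def \<delta>_def transfer_factor_nth szego_poly_Suc szego_rev_Suc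
          field_simps) (simp add: \<eta>' add_divide_distrib flip: mult.assoc)
  next
    case (Suc n)
    define u v where "u = T n $ 1 $ 1 + of_real \<eta> * inverse \<xi> * T n $ 1 $ 2"
      and "v = T n $ 2 $ 1 + of_real \<eta> * inverse \<xi> * T n $ 2 $ 2"
    define r where "r = complex_of_real (inverse (rho (\<gamma> (Suc n))))"
    define p q where "p = poly (szego_poly \<delta> (Suc n)) \<xi>" and "q = poly (szego_rev \<delta> (Suc n)) \<xi>"
    have K: "K (Suc n) = r * K n"
      by (simp add: K_def r_def)
    have uv: "u = K n * (inverse \<xi> ^ Suc n * p)" "v = K n * (of_real \<eta> * inverse \<xi> * q)"
      using Suc by (auto simp: u_def v_def p_def q_def)
    have "T (Suc n) $ 1 $ 1 + of_real \<eta> * inverse \<xi> * T (Suc n) $ 1 $ 2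
        = r * (u + cnj (\<gamma> (Suc n)) * inverse \<xi> ^ Suc n * v)"
      by (simp add: T_def matrix_matrix_mult_def sum_2 transfer_factor_nth u_def v_def r_def
          algebra_simps)
    also have "\<dots> = K (Suc n) * (inverse \<xi> ^ Suc (Suc n) * poly (szego_poly \<delta> (Suc (Suc n))) \<xi>)"
      using \<xi> unfolding uv K szego_poly_Suc[of \<delta> "Suc n"]
      by (simp add: \<delta>_def p_def[symmetric, unfolded \<delta>_def] q_def[symmetric, unfolded \<delta>_def]
          field_simps)
    finally have 1: "T (Suc n) $ 1 $ 1 + of_real \<eta> * inverse \<xi> * T (Suc n) $ 1 $ 2
        = K (Suc n) * (inverse \<xi> ^ Suc (Suc n) * poly (szego_poly \<delta> (Suc (Suc n))) \<xi>)" .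
    have "T (Suc n) $ 2 $ 1 + of_real \<eta> * inverse \<xi> * T (Suc n) $ 2 $ 2
        = r * (\<gamma> (Suc n) * \<xi> ^ Suc n * u + v)"
      by (simp add: T_def matrix_matrix_mult_def sum_2 transfer_factor_nth u_def v_def r_def
          algebra_simps)
    also have "\<xi> ^ Suc n * u = K n * p"
      using \<xi> unfolding uv by (simp add: field_simps)
    then have "r * (\<gamma> (Suc n) * \<xi> ^ Suc n * u + v)
        = r * (\<gamma> (Suc n) * (K n * p) + K n * (of_real \<eta> * inverse \<xi> * q))"
      unfolding uv(2) by (simp only: mult.assoc)
    also have "\<dots> = K (Suc n) * (of_real \<eta> * inverse \<xi> * q + of_real \<eta> * inverse \<xi> * (of_real \<eta> * \<gamma> (Suc n) * (\<xi> * p)))"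
    proof -
      have "of_real \<eta> * inverse \<xi> * (of_real \<eta> * \<gamma> (Suc n) * (\<xi> * p)) = (of_real \<eta> * of_real \<eta>) * (inverse \<xi> * \<xi>) * (\<gamma> (Suc n) * p)"
        by (simp only: mult_ac)
      also have "\<dots> = \<gamma> (Suc n) * p"
        using \<xi> \<eta>' by simp
      finally have cancel: "of_real \<eta> * inverse \<xi> * (of_real \<eta> * \<gamma> (Suc n) * (\<xi> * p)) = \<gamma> (Suc n) * p" .
      show ?thesis
        unfolding K cancel by (simp add: algebra_simps)
    qed
    also have "\<dots> = K (Suc n) * (of_real \<eta> * inverse \<xi> * poly (szego_rev \<delta> (Suc (Suc n))) \<xi>)"
      unfolding szego_rev_Suc[of \<delta> "Suc n"]
      by (simp add: p_def q_def \<delta>_def algebra_simps)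
    finally show ?case using 1 by simp
  qed
  then show "T n $ 1 $ 1 + of_real \<eta> * inverse \<xi> * T n $ 1 $ 2
           = K n * (inverse \<xi> ^ Suc n * poly (szego_poly \<delta> (Suc n)) \<xi>)"
    and "T n $ 2 $ 1 + of_real \<eta> * inverse \<xi> * T n $ 2 $ 2
           = K n * (of_real \<eta> * inverse \<xi> * poly (szego_rev \<delta> (Suc n)) \<xi>)" by auto
qed

text \<open>Recovers the Frobenius norm of one row from its products with the two starting vectors.\<close>

lemma cmod_parallelogram_circle:
  assumes "\<xi> \<in> circle"
  shows "(cmod (a + inverse \<xi> * b))\<^sup>2 + (cmod (a - inverse \<xi> * b))\<^sup>2 = 2 * ((cmod a)\<^sup>2 + (cmod b)\<^sup>2)"
proof -
  have "(cmod (a + c))\<^sup>2 + (cmod (a - c))\<^sup>2 = 2 * ((cmod a)\<^sup>2 + (cmod c)\<^sup>2)" for c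
    by (simp only: cmod_power2) (simp add: power2_eq_square algebra_simps)
  then show ?thesis
    using assms by (simp add: norm_mult norm_inverse)
qed

lemma frobenius_norm_transfer_prod:
  fixes \<gamma> :: "nat \<Rightarrow> complex"
  assumes \<xi>: "\<xi> \<in> circle"
  defines "K \<equiv> \<lambda>n. complex_of_real (\<Prod>k\<le>n. inverse (rho (\<gamma> k)))"
  shows "(frobenius_norm (transfer_prod \<xi> \<gamma> n - mat 1))\<^sup>2 =
      (cmod (K n * poly (szego_rev (\<lambda>k. - \<gamma> k) (Suc n)) \<xi> - 1))\<^sup>2
    + (cmod (K n * poly (szego_rev \<gamma> (Suc n)) \<xi> - 1))\<^sup>2"
proof -
  define T where "T = transfer_prod \<xi> \<gamma> n"
  have \<xi>0: "\<xi> \<noteq> 0" using \<xi> by auto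
  have ii: "inverse \<xi> ^ Suc n * (\<xi> ^ Suc n * z) = z" for z
  proof -
    have "inverse \<xi> ^ Suc n * \<xi> ^ Suc n = (inverse \<xi> * \<xi>) ^ Suc n"
      by (rule power_mult_distrib[symmetric])
    then show ?thesis
      using \<xi>0 by (simp only: mult.assoc[symmetric]) simp
  qed
  \<comment> \<open>On the circle \<open>\<xi>\<^sup>-\<^sup>n\<^sup>-\<^sup>1 \<Phi>\<^bsub>n+1\<^esub>\<close> is the conjugate of \<open>\<Phi>\<^bsub>n+1\<^esub>*\<close>, so both rows contribute equally.\<close>
  have flip: "cmod (K n * (inverse \<xi> ^ Suc n * poly (szego_poly \<delta> (Suc n)) \<xi>) - 1)
      = cmod (K n * poly (szego_rev \<delta> (Suc n)) \<xi> - 1)" for \<delta>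
  proof -
    have "K n * (inverse \<xi> ^ Suc n * poly (szego_poly \<delta> (Suc n)) \<xi>) - 1
        = cnj (K n * poly (szego_rev \<delta> (Suc n)) \<xi> - 1)"
      unfolding szego_poly_on_circle[OF \<xi>] ii by (simp add: K_def)
    then show ?thesis by (metis complex_mod_cnj)
  qed
  have row: "cmod (K n * (inverse \<xi> * q) - inverse \<xi>) = cmod (K n * q - 1)"
      "cmod (K n * (- inverse \<xi> * q) + inverse \<xi>) = cmod (K n * q - 1)" for q
  proof -
    have "K n * (inverse \<xi> * q) - inverse \<xi> = inverse \<xi> * (K n * q - 1)"
         "K n * (- inverse \<xi> * q) + inverse \<xi> = - inverse \<xi> * (K n * q - 1)"
      by (simp_all add: algebra_simps)
    then show "cmod (K n * (inverse \<xi> * q) - inverse \<xi>) = cmod (K n * q - 1)"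
      "cmod (K n * (- inverse \<xi> * q) + inverse \<xi>) = cmod (K n * q - 1)"
      using \<xi> by (simp_all only: norm_mult norm_minus_cancel norm_inverse) simp_all
  qed
  note plus = transfer_prod_szego[OF \<xi>0, of 1 \<gamma> n, folded T_def]
  note minus = transfer_prod_szego[OF \<xi>0, of "- 1" \<gamma> n, folded T_def]
  have "(frobenius_norm (T - mat 1))\<^sup>2
      = (cmod (T $ 1 $ 1 - 1))\<^sup>2 + (cmod (T $ 1 $ 2))\<^sup>2 + ((cmod (T $ 2 $ 1))\<^sup>2 + (cmod (T $ 2 $ 2 - 1))\<^sup>2)"
    by (simp add: frobenius_norm_eq_norm norm_vec_def L2_set_def sum_2 mat_def)
  moreover have "2 * ((cmod (T $ 1 $ 1 - 1))\<^sup>2 + (cmod (T $ 1 $ 2))\<^sup>2)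
      = (cmod (K n * poly (szego_rev (\<lambda>k. - \<gamma> k) (Suc n)) \<xi> - 1))\<^sup>2
        + (cmod (K n * poly (szego_rev \<gamma> (Suc n)) \<xi> - 1))\<^sup>2"
  proof -
    have "T $ 1 $ 1 - 1 + inverse \<xi> * T $ 1 $ 2
        = K n * (inverse \<xi> ^ Suc n * poly (szego_poly (\<lambda>k. - \<gamma> k) (Suc n)) \<xi>) - 1"
      "T $ 1 $ 1 - 1 - inverse \<xi> * T $ 1 $ 2
        = K n * (inverse \<xi> ^ Suc n * poly (szego_poly \<gamma> (Suc n)) \<xi>) - 1"
      using plus(1) minus(1) by (simp_all add: K_def algebra_simps)
    note eqs = this
    show ?thesis
      using cmod_parallelogram_circle[OF \<xi>, of "T $ 1 $ 1 - 1" "T $ 1 $ 2"]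
      unfolding eqs flip by (rule sym)
  qed
  moreover have "2 * ((cmod (T $ 2 $ 1))\<^sup>2 + (cmod (T $ 2 $ 2 - 1))\<^sup>2)
      = (cmod (K n * poly (szego_rev (\<lambda>k. - \<gamma> k) (Suc n)) \<xi> - 1))\<^sup>2
        + (cmod (K n * poly (szego_rev \<gamma> (Suc n)) \<xi> - 1))\<^sup>2"
  proof -
    have "T $ 2 $ 1 + inverse \<xi> * (T $ 2 $ 2 - 1)
        = K n * (inverse \<xi> * poly (szego_rev (\<lambda>k. - \<gamma> k) (Suc n)) \<xi>) - inverse \<xi>"
      "T $ 2 $ 1 - inverse \<xi> * (T $ 2 $ 2 - 1)
        = K n * (- inverse \<xi> * poly (szego_rev \<gamma> (Suc n)) \<xi>) + inverse \<xi>"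
      using plus(2) minus(2) by (simp_all add: K_def algebra_simps)
    note eqs = this
    show ?thesis
      using cmod_parallelogram_circle[OF \<xi>, of "T $ 2 $ 1" "T $ 2 $ 2 - 1"]
      unfolding eqs row by (rule sym)
  qed
  moreover have "x = s" if "x = a + b" "2 * a = s" "2 * b = s" for x a b s :: real
    using that by simp
  ultimately show ?thesis
    unfolding T_def by blast
qed

text \<open>\<open>K\<^sup>2 = exp (- \<Sum> ln (1 - |\<gamma>\<^sub>k|\<^sup>2)) \<le> exp (2 S) \<le> 1 + 4 S\<close>. The deviation \<open>K - 1\<close> is of order \<open>S\<close>, so
  its square is of order \<open>S\<^sup>2\<close>, of which only \<open>O(S)\<close> is kept.\<close>

lemma prod_inverse_rho_bounds:
  fixes \<gamma> :: "nat \<Rightarrow> complex"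
  assumes \<gamma>: "\<And>k. \<gamma> k \<in> ball 0 1" and S: "(\<Sum>k\<le>n. (cmod (\<gamma> k))\<^sup>2) \<le> S" "S \<le> 1 / 2"
  defines "K \<equiv> \<Prod>k\<le>n. inverse (rho (\<gamma> k))"
  shows "1 \<le> K" "K\<^sup>2 \<le> 4" "(K - 1)\<^sup>2 \<le> 8 * S"
proof -
  have "1 \<le> inverse (rho (\<gamma> k))" for k
    using rho_sq_pos[OF \<gamma>[of k]] by (auto simp: rho_def one_le_inverse_iff)
  then show K1: "1 \<le> K"
    unfolding K_def by (intro prod_ge_1) auto
  have pos: "0 < 1 - (cmod (\<gamma> k))\<^sup>2" for k
    using rho_sq_pos[OF \<gamma>] .
  have half: "(cmod (\<gamma> k))\<^sup>2 \<le> 1 / 2" if "k \<le> n" for k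
    using member_le_sum[of k "{..n}" "\<lambda>k. (cmod (\<gamma> k))\<^sup>2"] that S by auto
  have S0: "0 \<le> S"
    using S sum_nonneg[of "{..n}" "\<lambda>k. (cmod (\<gamma> k))\<^sup>2"] by simp
  have "K\<^sup>2 = (\<Prod>k\<le>n. exp (- ln (1 - (cmod (\<gamma> k))\<^sup>2)))"
    unfolding K_def prod_power_distrib
  proof (rule prod.cong[OF refl])
    fix k
    show "(inverse (rho (\<gamma> k)))\<^sup>2 = exp (- ln (1 - (cmod (\<gamma> k))\<^sup>2))"
      using pos[of k] by (simp add: rho_def exp_minus power_inverse)
  qed
  also have "\<dots> \<le> (\<Prod>k\<le>n. exp (2 * (cmod (\<gamma> k))\<^sup>2))"
    using minus_ln_one_minus_le[OF _ half] by (intro prod_mono) auto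
  also have "\<dots> = exp (2 * (\<Sum>k\<le>n. (cmod (\<gamma> k))\<^sup>2))"
    by (simp add: exp_sum sum_distrib_left)
  also have "\<dots> \<le> exp (2 * S)"
    using S by simp
  finally have K2: "K\<^sup>2 \<le> exp (2 * S)" .
  have "exp (2 * S) \<le> 1 + 2 * S + (2 * S)\<^sup>2"
    using S0 S by (intro exp_bound) auto
  also have "\<dots> \<le> 1 + 4 * S"
    using mult_left_mono[OF S(2) S0] by (simp add: power2_eq_square)
  finally have K2': "K\<^sup>2 \<le> 1 + 4 * S" using K2 by simp
  then show "K\<^sup>2 \<le> 4" using S by simp
  have "K \<le> K\<^sup>2"
    using K1 by (simp add: power2_eq_square)
  then have "(K - 1)\<^sup>2 \<le> (4 * S)\<^sup>2"
    using K1 K2' by (intro power_mono) auto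
  also have "\<dots> \<le> 8 * S"
    using mult_left_mono[OF S(2) S0] by (simp add: power2_eq_square)
  finally show "(K - 1)\<^sup>2 \<le> 8 * S" .
qed

lemma cmod_sq_scaled_minus_one_le:
  fixes K :: real and q :: complex
  assumes "1 \<le> K"
  shows "(cmod (K * q - 1))\<^sup>2 \<le> 2 * K\<^sup>2 * (cmod (q - 1))\<^sup>2 + 2 * (K - 1)\<^sup>2"
proof -
  have "K * q - 1 = K * (q - 1) + of_real (K - 1)"
    by (simp add: algebra_simps)
  then have "cmod (K * q - 1) \<le> cmod (K * (q - 1)) + cmod (of_real (K - 1))"
    using norm_triangle_ineq by metis
  also have "\<dots> = K * cmod (q - 1) + (K - 1)"
    using assms unfolding norm_mult norm_of_real by simp
  finally have "(cmod (K * q - 1))\<^sup>2 \<le> (K * cmod (q - 1) + (K - 1))\<^sup>2"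
    by (intro power_mono) auto
  also have "\<dots> \<le> 2 * K\<^sup>2 * (cmod (q - 1))\<^sup>2 + 2 * (K - 1)\<^sup>2"
    using sum_squares_bound[of "K * cmod (q - 1)" "K - 1"]
    by (simp add: power2_sum power_mult_distrib)
  finally show ?thesis .
qed

section \<open>Comparison of the maximal functions\<close>

text \<open>The passage from \<open>M\<^sup>2 d\<sigma>\<close> to \<open>log (1 + M\<^sup>2) dm\<close> for a Bernstein-Szego measure: the pointwise
  inequality \<open>ln_one_plus_le_entropy\<close> integrated over the circle. The finite maximum over \<open>n \<le> N\<close> is
  real valued and measurable, unlike the extended-real supremum, and it is all that the
  first \<open>N\<close> transfer products see.\<close>

lemma nn_integral_ln_maximal_le:
  assumes \<delta>: "\<And>k. \<delta> k \<in> ball 0 1" "\<forall>k\<ge>N. \<delta> k = 0" "\<And>k. (cmod (\<delta> k))\<^sup>2 \<le> 1 / 2"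
    and bound: "(\<integral>\<^sup>+\<xi>. (orth_poly_maximal \<xi> (bernstein_szego \<delta> N))\<^sup>2 \<partial>bernstein_szego \<delta> N) \<le> ennreal B"
    and B: "0 \<le> B"
  defines "X \<equiv> \<lambda>\<xi>. Max ((\<lambda>n. cmod (poly (szego_rev \<delta> n) \<xi> - 1)) ` {..N})"
  shows "(\<integral>\<^sup>+\<xi>. ennreal (ln (1 + 8 * (X \<xi>)\<^sup>2)) \<partial>circle_lebesgue)
           \<le> ennreal (16 * B + 8 * (\<Sum>k<N. (cmod (\<delta> k))\<^sup>2))"
proof -
  let ?w = "bernstein_szego_density \<delta> N"
  have X_meas [measurable]: "X \<in> borel_measurable circle_lebesgue"
    unfolding X_def
    by (intro borel_measurable_Max continuous_on_circle_measurable[OF sets_circle_lebesgue])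
       (auto intro!: continuous_intros)
  have w_meas [measurable]: "?w \<in> borel_measurable circle_lebesgue"
    by (rule bernstein_szego_density_measurable[OF \<delta>(1)])
  have w_pos: "0 < ?w \<xi>" if "\<xi> \<in> space circle_lebesgue" for \<xi>
    using bernstein_szego_density_pos[OF \<delta>(1)] that by (simp add: space_circle_lebesgue)
  have "(\<integral>\<^sup>+\<xi>. ennreal ((X \<xi>)\<^sup>2 * ?w \<xi>) \<partial>circle_lebesgue)
      = (\<integral>\<^sup>+\<xi>. ennreal (?w \<xi>) * ennreal ((X \<xi>)\<^sup>2) \<partial>circle_lebesgue)"
    using w_pos by (intro nn_integral_cong) (simp add: ennreal_mult less_imp_le mult.commute)
  also have "\<dots> = (\<integral>\<^sup>+\<xi>. ennreal ((X \<xi>)\<^sup>2) \<partial>bernstein_szego \<delta> N)"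
    unfolding bernstein_szego_def by (subst nn_integral_density) auto
  also have "\<dots> \<le> (\<integral>\<^sup>+\<xi>. (orth_poly_maximal \<xi> (bernstein_szego \<delta> N))\<^sup>2 \<partial>bernstein_szego \<delta> N)"
  proof (rule nn_integral_mono)
    fix \<xi>
    have "X \<xi> \<in> (\<lambda>n. cmod (poly (szego_rev \<delta> n) \<xi> - 1)) ` {..N}"
      unfolding X_def by (intro Max_in) auto
    then obtain n where n: "X \<xi> = cmod (poly (szego_rev \<delta> n) \<xi> - 1)" by auto
    then have "ennreal (X \<xi>) \<le> orth_poly_maximal \<xi> (bernstein_szego \<delta> N)"
      unfolding orth_poly_maximal_def orth_poly_bernstein_szego[OF \<delta>(1) \<delta>(2)] rev_poly_szego_poly
      by (auto intro!: SUP_upper)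
    then have "(ennreal (X \<xi>))\<^sup>2 \<le> (orth_poly_maximal \<xi> (bernstein_szego \<delta> N))\<^sup>2"
      by (rule power_mono) simp
    then show "ennreal ((X \<xi>)\<^sup>2) \<le> (orth_poly_maximal \<xi> (bernstein_szego \<delta> N))\<^sup>2"
      by (simp add: ennreal_power n)
  qed
  finally have main: "(\<integral>\<^sup>+\<xi>. ennreal ((X \<xi>)\<^sup>2 * ?w \<xi>) \<partial>circle_lebesgue) \<le> ennreal B"
    using bound by (rule order_trans)
  have "(\<integral>\<^sup>+\<xi>. ennreal (ln (1 + 8 * (X \<xi>)\<^sup>2)) \<partial>circle_lebesgue)
      \<le> (\<integral>\<^sup>+\<xi>. 16 * ennreal ((X \<xi>)\<^sup>2 * ?w \<xi>) + 4 * ennreal (?w \<xi> - 1 - ln (?w \<xi>)) \<partial>circle_lebesgue)"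
  proof (rule nn_integral_mono)
    fix \<xi> assume "\<xi> \<in> space circle_lebesgue"
    note w = w_pos[OF this]
    have "0 \<le> ?w \<xi> - 1 - ln (?w \<xi>)"
      using ln_le_minus_one[OF w] by simp
    moreover have "16 * ennreal a + 4 * ennreal b = ennreal (16 * a + 4 * b)"
      if "0 \<le> a" "0 \<le> b" for a b
      using that by (simp add: ennreal_mult')
    ultimately have "16 * ennreal ((X \<xi>)\<^sup>2 * ?w \<xi>) + 4 * ennreal (?w \<xi> - 1 - ln (?w \<xi>))
        = ennreal (16 * ((X \<xi>)\<^sup>2 * ?w \<xi>) + 4 * (?w \<xi> - 1 - ln (?w \<xi>)))"
      using w by simp
    then show "ennreal (ln (1 + 8 * (X \<xi>)\<^sup>2))
        \<le> 16 * ennreal ((X \<xi>)\<^sup>2 * ?w \<xi>) + 4 * ennreal (?w \<xi> - 1 - ln (?w \<xi>))"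
      using ln_one_plus_le_entropy[OF w, of "X \<xi>"] by (simp add: ennreal_leI mult.assoc)
  qed
  also have "\<dots> = 16 * (\<integral>\<^sup>+\<xi>. ennreal ((X \<xi>)\<^sup>2 * ?w \<xi>) \<partial>circle_lebesgue)
      + 4 * (\<integral>\<^sup>+\<xi>. ennreal (?w \<xi> - 1 - ln (?w \<xi>)) \<partial>circle_lebesgue)"
    by (simp add: nn_integral_add nn_integral_cmult)
  also have "\<dots> \<le> 16 * ennreal B + 4 * ennreal (2 * (\<Sum>k<N. (cmod (\<delta> k))\<^sup>2))"
    using main bernstein_szego_entropy[OF \<delta>(1) \<delta>(3)] by (intro add_mono mult_left_mono) auto
  also have "\<dots> = ennreal (16 * B + 8 * (\<Sum>k<N. (cmod (\<delta> k))\<^sup>2))"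
    using B by (simp add: ennreal_mult' ennreal_plus sum_nonneg)
  finally show ?thesis .
qed

lemma ln_one_plus_sum_le:
  fixes a b c :: real
  assumes "0 \<le> a" "0 \<le> b" "0 \<le> c"
  shows "ln (1 + (a + b + c)) \<le> ln (1 + a) + ln (1 + b) + c"
proof -
  have "1 + (a + b + c) \<le> (1 + a) * (1 + b) * (1 + c)"
    using assms by (simp add: algebra_simps)
  then have "ln (1 + (a + b + c)) \<le> ln ((1 + a) * (1 + b) * (1 + c))"
    using assms by (intro ln_mono) auto
  also have "\<dots> = ln (1 + a) + ln (1 + b) + ln (1 + c)"
    using assms by (simp add: ln_mult)
  also have "ln (1 + c) \<le> c"
    using assms by (intro ln_add_one_self_le_self)
  finally show ?thesis by simp
qed

lemma frobenius_norm_transfer_prod_le: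
  assumes \<gamma>: "\<And>k. \<gamma> k \<in> ball 0 1" and S: "(\<Sum>k\<le>n. (cmod (\<gamma> k))\<^sup>2) \<le> S" "S \<le> 1 / 2"
    and \<xi>: "\<xi> \<in> circle"
  shows "(frobenius_norm (transfer_prod \<xi> \<gamma> n - mat 1))\<^sup>2
    \<le> 8 * (cmod (poly (szego_rev (\<lambda>k. - \<gamma> k) (Suc n)) \<xi> - 1))\<^sup>2
      + 8 * (cmod (poly (szego_rev \<gamma> (Suc n)) \<xi> - 1))\<^sup>2 + 32 * S"
proof -
  define K where "K = (\<Prod>k\<le>n. inverse (rho (\<gamma> k)))"
  note K = prod_inverse_rho_bounds[OF \<gamma> S, folded K_def]
  have "(cmod (of_real K * q - 1))\<^sup>2 \<le> 8 * (cmod (q - 1))\<^sup>2 + 16 * S" for q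
    using cmod_sq_scaled_minus_one_le[OF K(1), of q] K(3)
      mult_right_mono[OF K(2), of "2 * (cmod (q - 1))\<^sup>2"] by simp
  from add_mono[OF this this] show ?thesis
    unfolding frobenius_norm_transfer_prod[OF \<xi>] K_def[symmetric]
    by (rule order_trans) simp
qed

section \<open>The implication\<close>

theorem theorem2p1:
  shows "qNCC_I \<longrightarrow> qNCC_II"
proof
  assume qNCC_I
  then obtain \<epsilon> C where \<epsilon>: "0 < \<epsilon>" and C: "0 < C"
    and I: "\<And>\<sigma> \<gamma>. \<sigma> \<in> circle_prob_measures \<Longrightarrow> schur_parameters \<sigma> \<gamma> \<Longrightarrow> square_summable \<gamma> \<Longrightarrow>
        l2_norm \<gamma> \<le> \<epsilon> \<Longrightarrow> (\<integral>\<^sup>+\<xi>. (orth_poly_maximal \<xi> \<sigma>)\<^sup>2 \<partial>\<sigma>) \<le> ennreal (C * (l2_norm \<gamma>)\<^sup>2)"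
    unfolding qNCC_I_def by blast
  show qNCC_II
    unfolding qNCC_II_def
  proof (rule exI[of _ "min \<epsilon> (1 / 2)"], intro conjI exI[of _ "32 * C + 48"] allI impI)
    show "0 < min \<epsilon> (1 / 2)" "0 < 32 * C + 48" using \<epsilon> C by auto
  next
    fix \<gamma> :: "nat \<Rightarrow> complex"
    assume asm: "(\<forall>n. \<gamma> n \<in> ball 0 1) \<and> square_summable \<gamma> \<and> l2_norm \<gamma> \<le> min \<epsilon> (1 / 2)"
    then have \<gamma>: "\<And>n. \<gamma> n \<in> ball 0 1" and summable: "summable (\<lambda>n. (cmod (\<gamma> n))\<^sup>2)"
      by (auto simp: square_summable_def)
    define S where "S = (l2_norm \<gamma>)\<^sup>2"
    have S: "S = (\<Sum>n. (cmod (\<gamma> n))\<^sup>2)"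
      unfolding S_def l2_norm_def using summable by (simp add: suminf_nonneg)
    have S0: "0 \<le> S" by (simp add: S_def)
    have "0 \<le> l2_norm \<gamma>"
      unfolding l2_norm_def using summable by (simp add: suminf_nonneg)
    then have "S \<le> (1 / 2)\<^sup>2"
      unfolding S_def using asm by (intro power_mono) auto
    then have S_half: "S \<le> 1 / 2" by (simp add: power2_eq_square)
    have S_sum: "(\<Sum>k\<in>A. (cmod (\<gamma> k))\<^sup>2) \<le> S" if "finite A" for A
      unfolding S using summable that by (intro sum_le_suminf) auto
    define X where "X N \<delta> \<xi> = Max ((\<lambda>n. cmod (poly (szego_rev \<delta> n) \<xi> - 1)) ` {..N})"
      for N \<delta> and \<xi> :: complex
    define f where "f \<xi> n = frobenius_norm (transfer_prod \<xi> \<gamma> n - mat 1)" for \<xi> n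
    define h where "h N \<xi> = ennreal (ln (1 + Max ((\<lambda>n. (f \<xi> n)\<^sup>2) ` {..N})))" for N \<xi>

    \<comment> \<open>Stated through \<open>|\<delta> k|\<close> so as to cover the truncations of both \<open>\<gamma>\<close> and \<open>- \<gamma>\<close>.\<close>
    have X_bound: "(\<integral>\<^sup>+\<xi>. ennreal (ln (1 + 8 * (X N \<delta> \<xi>)\<^sup>2)) \<partial>circle_lebesgue) \<le> ennreal ((16 * C + 8) * S)"
      if "\<And>k. cmod (\<delta> k) = (if k < N then cmod (\<gamma> k) else 0)" for \<delta> N
    proof -
      have ball: "\<delta> k \<in> ball 0 1" for k
        using \<gamma>[of k] that[of k] by auto
      have zero: "\<forall>k\<ge>N. \<delta> k = 0"
        using that by (metis leD norm_eq_zero)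
      have half: "(cmod (\<delta> k))\<^sup>2 \<le> 1 / 2" for k
        using S_sum[of "{k}"] S_half S0 that[of k] by auto
      have sums: "(\<lambda>k. (cmod (\<delta> k))\<^sup>2) sums (\<Sum>k<N. (cmod (\<delta> k))\<^sup>2)"
        using zero by (intro sums_finite) auto
      have sum_le: "(\<Sum>k<N. (cmod (\<delta> k))\<^sup>2) \<le> S"
        using S_sum[of "{..<N}"] that by simp
      have "(l2_norm \<delta>)\<^sup>2 = (\<Sum>k<N. (cmod (\<delta> k))\<^sup>2)"
        unfolding l2_norm_def sums_unique[OF sums, symmetric] by (simp add: sum_nonneg)
      moreover have "l2_norm \<delta> \<le> l2_norm \<gamma>"
        unfolding l2_norm_def sums_unique[OF sums, symmetric] using sum_le S by simp
      ultimately have "(\<integral>\<^sup>+\<xi>. (orth_poly_maximal \<xi> (bernstein_szego \<delta> N))\<^sup>2 \<partial>bernstein_szego \<delta> N)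
          \<le> ennreal (C * (\<Sum>k<N. (cmod (\<delta> k))\<^sup>2))"
        using I[OF bernstein_szego_in_circle_prob_measures[OF ball]
            schur_parameters_bernstein_szego[OF ball zero]] sums_summable[OF sums] asm
        by (simp add: square_summable_def)
      also have "\<dots> \<le> ennreal (C * S)"
        using sum_le C by (intro ennreal_leI mult_left_mono) auto
      finally have "(\<integral>\<^sup>+\<xi>. ennreal (ln (1 + 8 * (X N \<delta> \<xi>)\<^sup>2)) \<partial>circle_lebesgue)
          \<le> ennreal (16 * (C * S) + 8 * (\<Sum>k<N. (cmod (\<delta> k))\<^sup>2))"
        unfolding X_def using C S0 by (intro nn_integral_ln_maximal_le ball zero half) auto
      also have "\<dots> \<le> ennreal ((16 * C + 8) * S)"
        using sum_le by (intro ennreal_leI) (simp add: algebra_simps)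
      finally show ?thesis .
    qed

    \<comment> \<open>The first \<open>N + 1\<close> products involve \<open>\<gamma>\<^sub>0, \<dots>, \<gamma>\<^sub>N\<close> and polynomials of degree at most \<open>N + 1\<close>.\<close>
    have h_bound: "(\<integral>\<^sup>+\<xi>. h N \<xi> \<partial>circle_lebesgue) \<le> ennreal ((32 * C + 48) * S)" for N
    proof -
      define \<delta> \<delta>' where "\<delta> k = (if k < Suc N then \<gamma> k else 0)"
        and "\<delta>' k = (if k < Suc N then - \<gamma> k else 0)" for k
      let ?M = "\<lambda>\<delta> \<xi>. 8 * (X (Suc N) \<delta> \<xi>)\<^sup>2"
      have X_meas [measurable]: "X (Suc N) \<delta> \<in> borel_measurable circle_lebesgue" for \<delta>
        unfolding X_def
        by (intro borel_measurable_Max continuous_on_circle_measurable[OF sets_circle_lebesgue])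
           (auto intro!: continuous_intros)
      have "(\<integral>\<^sup>+\<xi>. h N \<xi> \<partial>circle_lebesgue)
          \<le> (\<integral>\<^sup>+\<xi>. ennreal (ln (1 + ?M \<delta>' \<xi>)) + ennreal (ln (1 + ?M \<delta> \<xi>)) + ennreal (32 * S) \<partial>circle_lebesgue)"
      proof (rule nn_integral_mono)
        fix \<xi> assume "\<xi> \<in> space circle_lebesgue"
        then have \<xi>: "\<xi> \<in> circle" by (simp add: space_circle_lebesgue)
        have X_ge: "(cmod (poly (szego_rev \<delta> (Suc n)) \<xi> - 1))\<^sup>2 \<le> (X (Suc N) \<delta> \<xi>)\<^sup>2" if "n \<le> N" for n \<delta>
          unfolding X_def using that by (intro power_mono Max_ge) auto
        have "(f \<xi> n)\<^sup>2 \<le> ?M \<delta>' \<xi> + ?M \<delta> \<xi> + 32 * S" if "n \<le> N" for n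
        proof -
          have "szego_rev (\<lambda>k. - \<gamma> k) (Suc n) = szego_rev \<delta>' (Suc n)" "szego_rev \<gamma> (Suc n) = szego_rev \<delta> (Suc n)"
            using that by (auto intro!: szego_cong simp: \<delta>_def \<delta>'_def)
          then show ?thesis
            using frobenius_norm_transfer_prod_le[OF \<gamma> S_sum[OF finite_atMost] S_half \<xi>, of n]
              X_ge[OF that, of \<delta>] X_ge[OF that, of \<delta>'] by (simp add: f_def)
        qed
        then have "Max ((\<lambda>n. (f \<xi> n)\<^sup>2) ` {..N}) \<le> ?M \<delta>' \<xi> + ?M \<delta> \<xi> + 32 * S"
          by (intro Max.boundedI) auto
        moreover have "0 \<le> Max ((\<lambda>n. (f \<xi> n)\<^sup>2) ` {..N})"
          by (rule order_trans[of _ "(f \<xi> 0)\<^sup>2"]) (auto intro!: Max_ge)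
        ultimately have "ln (1 + Max ((\<lambda>n. (f \<xi> n)\<^sup>2) ` {..N})) \<le> ln (1 + (?M \<delta>' \<xi> + ?M \<delta> \<xi> + 32 * S))"
          by (intro ln_mono) auto
        also have "\<dots> \<le> ln (1 + ?M \<delta>' \<xi>) + ln (1 + ?M \<delta> \<xi>) + 32 * S"
          using S0 by (intro ln_one_plus_sum_le) auto
        finally show "h N \<xi> \<le> ennreal (ln (1 + ?M \<delta>' \<xi>)) + ennreal (ln (1 + ?M \<delta> \<xi>)) + ennreal (32 * S)"
          using S0 by (simp add: h_def ennreal_leI flip: ennreal_plus)
      qed
      also have "\<dots> = (\<integral>\<^sup>+\<xi>. ennreal (ln (1 + ?M \<delta>' \<xi>)) \<partial>circle_lebesgue)
          + (\<integral>\<^sup>+\<xi>. ennreal (ln (1 + ?M \<delta> \<xi>)) \<partial>circle_lebesgue) + ennreal (32 * S)"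
        by (simp add: nn_integral_add prob_space.emeasure_space_1[OF prob_space_circle_lebesgue])
      also have "\<dots> \<le> ennreal ((16 * C + 8) * S) + ennreal ((16 * C + 8) * S) + ennreal (32 * S)"
        by (intro add_mono X_bound) (auto simp: \<delta>_def \<delta>'_def)
      also have "\<dots> = ennreal ((32 * C + 48) * S)"
        using C S0 by (simp add: algebra_simps flip: ennreal_plus)
      finally show ?thesis .
    qed

    \<comment> \<open>Measurability is read off from the formula in terms of polynomials, which are continuous.\<close>
    have h_meas: "h N \<in> borel_measurable circle_lebesgue" for N
    proof -
      define g where "g n \<xi> = (cmod (complex_of_real (\<Prod>k\<le>n. inverse (rho (\<gamma> k))) * poly (szego_rev (\<lambda>k. - \<gamma> k) (Suc n)) \<xi> - 1))\<^sup>2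
          + (cmod (complex_of_real (\<Prod>k\<le>n. inverse (rho (\<gamma> k))) * poly (szego_rev \<gamma> (Suc n)) \<xi> - 1))\<^sup>2" for n \<xi>
      have g: "g n \<in> borel_measurable circle_lebesgue" for n
        unfolding g_def
        by (intro continuous_on_circle_measurable[OF sets_circle_lebesgue] continuous_intros)
      have "(\<lambda>\<xi>. ennreal (ln (1 + Max ((\<lambda>n. g n \<xi>) ` {..N})))) \<in> borel_measurable circle_lebesgue"
        using g by (intro measurable_compose[OF _ measurable_ennreal] borel_measurable_ln borel_measurable_add
            borel_measurable_Max) auto
      moreover have "h N \<xi> = ennreal (ln (1 + Max ((\<lambda>n. g n \<xi>) ` {..N})))" if "\<xi> \<in> space circle_lebesgue" for \<xi>
        using frobenius_norm_transfer_prod[of \<xi> \<gamma>] that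
        by (simp add: h_def f_def g_def space_circle_lebesgue)
      ultimately show ?thesis
        by (simp cong: measurable_cong)
    qed
    have h_mono: "incseq h"
    proof (intro incseq_SucI le_funI)
      fix N \<xi>
      have "Max ((\<lambda>n. (f \<xi> n)\<^sup>2) ` {..N}) \<le> Max ((\<lambda>n. (f \<xi> n)\<^sup>2) ` {..Suc N})"
        by (intro Max_mono image_mono) auto
      moreover have "0 \<le> Max ((\<lambda>n. (f \<xi> n)\<^sup>2) ` {..N})"
        by (rule order_trans[of _ "(f \<xi> 0)\<^sup>2"]) (auto intro!: Max_ge)
      ultimately show "h N \<xi> \<le> h (Suc N) \<xi>"
        unfolding h_def by (intro ennreal_leI ln_mono) auto
    qed
    have "(\<integral>\<^sup>+\<xi>. ln_ennreal (1 + (transfer_maximal \<xi> \<gamma>)\<^sup>2) \<partial>circle_lebesgue)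
        \<le> (\<integral>\<^sup>+\<xi>. (SUP N. h N \<xi>) \<partial>circle_lebesgue)"
      unfolding transfer_maximal_def h_def f_def
      by (intro nn_integral_mono ln_ennreal_SUP_le) (simp add: frobenius_norm_eq_norm)
    also have "\<dots> = (SUP N. \<integral>\<^sup>+\<xi>. h N \<xi> \<partial>circle_lebesgue)"
      by (rule nn_integral_monotone_convergence_SUP[OF h_mono h_meas])
    also have "\<dots> \<le> ennreal ((32 * C + 48) * S)"
      by (intro SUP_least h_bound)
    finally show "(\<integral>\<^sup>+\<xi>. ln_ennreal (1 + (transfer_maximal \<xi> \<gamma>)\<^sup>2) \<partial>circle_lebesgue)
        \<le> ennreal ((32 * C + 48) * (l2_norm \<gamma>)\<^sup>2)"
      by (simp only: S_def)
  qed
qed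

end
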